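(* Let $G$ be a finite group acting on a ring $\Gamma$ by ring automorphisms, and let $\Lambda=\Gamma\ltimes_\theta M$ be a $G$-equivariant $\theta$-extension, with $G$ acting on $\Lambda$ by the ring automorphisms ${}^g(\gamma,m)=({}^g\gamma,{}^gm)$. Then there is an isomorphism of rings $$\Lambda\# G\cong(\Gamma\# G)\ltimes_{\widehat\theta}(M\# G).$$
   Context: Rings are associative with identity. $\theta$-extension: for a ring $\Gamma$, a $\Gamma$-bimodule $M$ and an associative $\Gamma$-bimodule homomorphism $\theta\colon M\otimes_\Gamma M\to M$, the ring $\Gamma\ltimes_\theta M$ has underlying group $\Gamma\oplus M$ and multiplication $(\gamma,m)(\gamma',m')=(\gamma\gamma',\gamma m'+m\gamma'+\theta(m\otimes m'))$. $G$-equivariance: let $G$ act on $\Gamma$ by ring automorphisms, written $\gamma\mapsto{}^g\gamma$. The $\theta$-extension $\Gamma\ltimes_\theta M$ is $G$-equivariant if $M$ is equipped with an (additive) $G$-action $m\mapsto{}^g m$ with ${}^g(\gamma m\gamma')={}^g\gamma\,{}^gm\,{}^g\gamma'$ and ${}^g(\theta(m\otimes m'))=\theta({}^gm\otimes{}^gm')$ for all $g\in G$, $\gamma,\gamma'\in\Gamma$, $m,m'\in M$. Skew group ring: for $G$ acting on a ring $R$ by ring automorphisms, $R\# G$ is the free left $R$-module on $G$, with elements $\sum_g r_g\# g$ and multiplication $(r\# g)(r'\# g')=r\,({}^gr')\# gg'$. Induced bimodule: $M\# G$ is the abelian group of formal sums $\sum_{g\in G}m_g\# g$ ($m_g\in M$),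 with $\Gamma\# G$-bimodule structure $(\gamma\# g)(m\# h)(\gamma'\# g')=\gamma({}^gm)({}^{gh}\gamma')\# ghg'$. Induced homomorphism $\widehat\theta\colon(M\# G)\otimes_{\Gamma\# G}(M\# G)\to M\# G$: $\widehat\theta\big((m\# g)\otimes(m'\# h)\big)=\theta(m\otimes{}^gm')\# gh$; it is an associative $\Gamma\# G$-bimodule homomorphism. *)

theory Defs
  imports "HOL-Algebra.Module" "HOL-Algebra.QuotRing" "HOL-Algebra.Group_Action" "HOL-Algebra.Free_Abelian_Groups"
begin

section \<open>Bimodules and their tensor product over a noncommutative ring\<close>

text \<open>As for the library's \<open>module\<close> records, the ring multiplication and unit of
  a bimodule record carry no meaning.\<close>

record ('a, 'b) bimodule = "('a, 'b) module" +
  rsmult :: "'b \<Rightarrow> 'a \<Rightarrow> 'b" (infixl \<open>\<triangleleft>\<index>\<close> 70)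

locale bimodule = R?: ring R + M?: abelian_group M for R (structure) and M (structure) +
  assumes lsmult_closed:
      "\<lbrakk>a \<in> carrier R; x \<in> carrier M\<rbrakk> \<Longrightarrow> a \<odot>\<^bsub>M\<^esub> x \<in> carrier M"
    and lsmult_l_distr:
      "\<lbrakk>a \<in> carrier R; b \<in> carrier R; x \<in> carrier M\<rbrakk> \<Longrightarrow>
        (a \<oplus>\<^bsub>R\<^esub> b) \<odot>\<^bsub>M\<^esub> x = a \<odot>\<^bsub>M\<^esub> x \<oplus>\<^bsub>M\<^esub> b \<odot>\<^bsub>M\<^esub> x"
    and lsmult_r_distr:
      "\<lbrakk>a \<in> carrier R; x \<in> carrier M; y \<in> carrier M\<rbrakk> \<Longrightarrow>
        a \<odot>\<^bsub>M\<^esub> (x \<oplus>\<^bsub>M\<^esub> y) = a \<odot>\<^bsub>M\<^esub> x \<oplus>\<^bsub>M\<^esub> a \<odot>\<^bsub>M\<^esub> y"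
    and lsmult_assoc:
      "\<lbrakk>a \<in> carrier R; b \<in> carrier R; x \<in> carrier M\<rbrakk> \<Longrightarrow>
        (a \<otimes>\<^bsub>R\<^esub> b) \<odot>\<^bsub>M\<^esub> x = a \<odot>\<^bsub>M\<^esub> (b \<odot>\<^bsub>M\<^esub> x)"
    and lsmult_one: "x \<in> carrier M \<Longrightarrow> \<one>\<^bsub>R\<^esub> \<odot>\<^bsub>M\<^esub> x = x"
    and rsmult_closed:
      "\<lbrakk>a \<in> carrier R; x \<in> carrier M\<rbrakk> \<Longrightarrow> x \<triangleleft>\<^bsub>M\<^esub> a \<in> carrier M"
    and rsmult_r_distr:
      "\<lbrakk>a \<in> carrier R; b \<in> carrier R; x \<in> carrier M\<rbrakk> \<Longrightarrow>
        x \<triangleleft>\<^bsub>M\<^esub> (a \<oplus>\<^bsub>R\<^esub> b) = x \<triangleleft>\<^bsub>M\<^esub> a \<oplus>\<^bsub>M\<^esub> x \<triangleleft>\<^bsub>M\<^esub> b"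
    and rsmult_l_distr:
      "\<lbrakk>a \<in> carrier R; x \<in> carrier M; y \<in> carrier M\<rbrakk> \<Longrightarrow>
        (x \<oplus>\<^bsub>M\<^esub> y) \<triangleleft>\<^bsub>M\<^esub> a = x \<triangleleft>\<^bsub>M\<^esub> a \<oplus>\<^bsub>M\<^esub> y \<triangleleft>\<^bsub>M\<^esub> a"
    and rsmult_assoc:
      "\<lbrakk>a \<in> carrier R; b \<in> carrier R; x \<in> carrier M\<rbrakk> \<Longrightarrow>
        x \<triangleleft>\<^bsub>M\<^esub> (a \<otimes>\<^bsub>R\<^esub> b) = (x \<triangleleft>\<^bsub>M\<^esub> a) \<triangleleft>\<^bsub>M\<^esub> b"
    and rsmult_one: "x \<in> carrier M \<Longrightarrow> x \<triangleleft>\<^bsub>M\<^esub> \<one>\<^bsub>R\<^esub> = x"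
    and lsmult_rsmult:
      "\<lbrakk>a \<in> carrier R; b \<in> carrier R; x \<in> carrier M\<rbrakk> \<Longrightarrow>
        (a \<odot>\<^bsub>M\<^esub> x) \<triangleleft>\<^bsub>M\<^esub> b = a \<odot>\<^bsub>M\<^esub> (x \<triangleleft>\<^bsub>M\<^esub> b)"

definition bimodule_hom ::
  "('a, 'c) ring_scheme \<Rightarrow> ('a, 'm, 'd) bimodule_scheme \<Rightarrow> ('a, 'n, 'e) bimodule_scheme
    \<Rightarrow> ('m \<Rightarrow> 'n) set" where
  "bimodule_hom R M N =
    {f \<in> hom (add_monoid M) (add_monoid N).
      \<forall>a \<in> carrier R. \<forall>x \<in> carrier M.
        f (a \<odot>\<^bsub>M\<^esub> x) = a \<odot>\<^bsub>N\<^esub> f x \<and> f (x \<triangleleft>\<^bsub>M\<^esub> a) = f x \<triangleleft>\<^bsub>N\<^esub> a}"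

definition tensor_relators ::
  "('a, 'c) ring_scheme \<Rightarrow> ('a, 'm, 'd) bimodule_scheme \<Rightarrow> ('a, 'n, 'e) bimodule_scheme
    \<Rightarrow> ('m \<times> 'n \<Rightarrow>\<^sub>0 int) set" where
  "tensor_relators R M N =
     {frag_of (x \<oplus>\<^bsub>M\<^esub> x', y) - frag_of (x, y) - frag_of (x', y) | x x' y.
        x \<in> carrier M \<and> x' \<in> carrier M \<and> y \<in> carrier N} \<union>
     {frag_of (x, y \<oplus>\<^bsub>N\<^esub> y') - frag_of (x, y) - frag_of (x, y') | x y y'.
        x \<in> carrier M \<and> y \<in> carrier N \<and> y' \<in> carrier N} \<union>
     {frag_of (x \<triangleleft>\<^bsub>M\<^esub> a, y) - frag_of (x, a \<odot>\<^bsub>N\<^esub> y) | x a y.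
        x \<in> carrier M \<and> a \<in> carrier R \<and> y \<in> carrier N}"

definition tensor_kernel ::
  "('a, 'c) ring_scheme \<Rightarrow> ('a, 'm, 'd) bimodule_scheme \<Rightarrow> ('a, 'n, 'e) bimodule_scheme
    \<Rightarrow> ('m \<times> 'n \<Rightarrow>\<^sub>0 int) set" where
  "tensor_kernel R M N =
     generate (free_Abelian_group (carrier M \<times> carrier N)) (tensor_relators R M N)"

definition tensor_class ::
  "('a, 'c) ring_scheme \<Rightarrow> ('a, 'm, 'd) bimodule_scheme \<Rightarrow> ('a, 'n, 'e) bimodule_scheme
    \<Rightarrow> ('m \<times> 'n \<Rightarrow>\<^sub>0 int) \<Rightarrow> ('m \<times> 'n \<Rightarrow>\<^sub>0 int) set" where
  "tensor_class R M N c =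
     tensor_kernel R M N #>\<^bsub>free_Abelian_group (carrier M \<times> carrier N)\<^esub> c"

definition tensor ::
  "('a, 'c) ring_scheme \<Rightarrow> ('a, 'm, 'd) bimodule_scheme \<Rightarrow> ('a, 'n, 'e) bimodule_scheme
    \<Rightarrow> 'm \<Rightarrow> 'n \<Rightarrow> ('m \<times> 'n \<Rightarrow>\<^sub>0 int) set" where
  "tensor R M N x y = tensor_class R M N (frag_of (x, y))"

text \<open>The outer actions are \<open>a (x \<otimes> y) = a x \<otimes> y\<close> and \<open>(x \<otimes> y) a = x \<otimes> y a\<close>, extended
  additively; each union below is over equal cosets.\<close>

definition tensor_product ::
  "('a, 'c) ring_scheme \<Rightarrow> ('a, 'm, 'd) bimodule_scheme \<Rightarrow> ('a, 'n, 'e) bimodule_scheme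
    \<Rightarrow> ('a, ('m \<times> 'n \<Rightarrow>\<^sub>0 int) set) bimodule" where
  "tensor_product R M N =
     (let T = free_Abelian_group (carrier M \<times> carrier N) Mod tensor_kernel R M N in
      \<lparr>carrier = carrier T, monoid.mult = undefined, one = undefined,
       ring.zero = \<one>\<^bsub>T\<^esub>, add = monoid.mult T,
       smult = (\<lambda>a X. \<Union>c\<in>X. tensor_class R M N
                  (frag_extend (\<lambda>(x, y). frag_of (a \<odot>\<^bsub>M\<^esub> x, y)) c)),
       rsmult = (\<lambda>X a. \<Union>c\<in>X. tensor_class R M N
                  (frag_extend (\<lambda>(x, y). frag_of (x, y \<triangleleft>\<^bsub>N\<^esub> a)) c))\<rparr>)"

text \<open>The map on the tensor product induced by a biadditive balanced map \<open>\<beta>\<close> into \<open>A\<close>: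
  the class of \<open>\<Sum>\<^sub>i n\<^sub>i (x\<^sub>i, y\<^sub>i)\<close> goes to \<open>\<Sum>\<^sub>i n\<^sub>i \<beta>(x\<^sub>i, y\<^sub>i)\<close>.\<close>

definition tensor_lift ::
  "('b, 'c) ring_scheme \<Rightarrow> ('m \<Rightarrow> 'n \<Rightarrow> 'b) \<Rightarrow> ('m \<times> 'n \<Rightarrow>\<^sub>0 int) set \<Rightarrow> 'b" where
  "tensor_lift A \<beta> X =
     the_elem ((\<lambda>c. \<Oplus>\<^bsub>A\<^esub>p \<in> Poly_Mapping.keys c.
                      [Poly_Mapping.lookup c p] \<cdot>\<^bsub>A\<^esub> \<beta> (fst p) (snd p)) ` X)"

lemma tensor_lift_tensor:
  fixes A (structure)
  assumes "abelian_group A" "bimodule R M" "bimodule R N"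
    and closed: "\<And>x y. \<lbrakk>x \<in> carrier M; y \<in> carrier N\<rbrakk> \<Longrightarrow> \<beta> x y \<in> carrier A"
    and addl: "\<And>x x' y. \<lbrakk>x \<in> carrier M; x' \<in> carrier M; y \<in> carrier N\<rbrakk> \<Longrightarrow>
      \<beta> (x \<oplus>\<^bsub>M\<^esub> x') y = \<beta> x y \<oplus>\<^bsub>A\<^esub> \<beta> x' y"
    and addr: "\<And>x y y'. \<lbrakk>x \<in> carrier M; y \<in> carrier N; y' \<in> carrier N\<rbrakk> \<Longrightarrow>
      \<beta> x (y \<oplus>\<^bsub>N\<^esub> y') = \<beta> x y \<oplus>\<^bsub>A\<^esub> \<beta> x y'"
    and bal: "\<And>x a y. \<lbrakk>x \<in> carrier M; a \<in> carrier R; y \<in> carrier N\<rbrakk> \<Longrightarrow>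
      \<beta> (x \<triangleleft>\<^bsub>M\<^esub> a) y = \<beta> x (a \<odot>\<^bsub>N\<^esub> y)"
    and xy: "x \<in> carrier M" "y \<in> carrier N"
  shows "tensor_lift A \<beta> (tensor R M N x y) = \<beta> x y"
proof -
  interpret A: abelian_group A by fact
  interpret M: bimodule R M by fact
  interpret N: bimodule R N by fact
  let ?S = "carrier M \<times> carrier N"
  let ?F = "free_Abelian_group ?S"
  define b where "b p = \<beta> (fst p) (snd p)" for p
  define H where "H c = (\<Oplus>p \<in> Poly_Mapping.keys c. [Poly_Mapping.lookup c p] \<cdot> b p)" for c :: "_ \<Rightarrow>\<^sub>0 int"
  have b: "b p \<in> carrier A" if "p \<in> ?S" for p using that closed by (auto simp: b_def)
  have Hext: "H c = (\<Oplus>p \<in> T. [Poly_Mapping.lookup c p] \<cdot> b p)"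
    if "Poly_Mapping.keys c \<subseteq> T" "finite T" "T \<subseteq> ?S" for c T
    unfolding H_def
  proof (rule A.add.finprod_mono_neutral_cong_left[OF that(2,1)])
    show "[poly_mapping.lookup c i] \<cdot> b i = \<zero>" if "i \<in> T - Poly_Mapping.keys c" for i using that
      by (auto simp: in_keys_iff add_pow_def int_pow_0)
  qed (use b that in \<open>auto intro!: A.add.int_pow_closed\<close>)
  have H: "group_hom ?F (add_monoid A) H"
  proof (intro group_hom.intro group_hom_axioms.intro homI)
    fix c assume "c \<in> carrier ?F" thus "H c \<in> carrier (add_monoid A)"
      unfolding H_def using b by (auto intro!: A.finsum_closed A.add.int_pow_closed)
  next
    fix c d assume cd: "c \<in> carrier ?F" "d \<in> carrier ?F"
    let ?T = "Poly_Mapping.keys c \<union> Poly_Mapping.keys d"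
    have T: "?T \<subseteq> ?S" using cd by auto
    have "H (c + d) = (\<Oplus>p \<in> ?T. [Poly_Mapping.lookup (c + d) p] \<cdot> b p)"
      by (rule Hext) (use keys_add[of c d] T in auto)
    also have "\<dots> = (\<Oplus>p \<in> ?T. [Poly_Mapping.lookup c p] \<cdot> b p \<oplus> [Poly_Mapping.lookup d p] \<cdot> b p)"
      by (rule A.finsum_cong') (use b T in \<open>auto simp: lookup_add A.add.int_pow_mult intro!: A.add.int_pow_closed\<close>)
    also have "\<dots> = (\<Oplus>p \<in> ?T. [Poly_Mapping.lookup c p] \<cdot> b p) \<oplus> (\<Oplus>p \<in> ?T. [Poly_Mapping.lookup d p] \<cdot> b p)"
      by (rule A.finsum_addf) (use b T in \<open>auto intro!: A.add.int_pow_closed\<close>)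
    also have "\<dots> = H c \<oplus> H d"
      using Hext[of c ?T] Hext[of d ?T] T by simp
    finally show "H (c \<otimes>\<^bsub>?F\<^esub> d) = H c \<otimes>\<^bsub>add_monoid A\<^esub> H d" by simp
  qed (auto simp: A.add.is_group)
  interpret H: group_hom ?F "add_monoid A" H by fact
  have Hof: "H (frag_of p) = b p" if "p \<in> ?S" for p
    using that b by (simp add: H_def A.add.int_pow_1)
  have Hdiff: "H (c - d) = H c \<ominus> H d" if "c \<in> carrier ?F" "d \<in> carrier ?F" for c d
  proof -
    have "H (c - d) = H (c \<otimes>\<^bsub>?F\<^esub> inv\<^bsub>?F\<^esub> d)" using that by simp
    also have "\<dots> = H c \<ominus> H d"
      using that H.hom_mult[of c "inv\<^bsub>?F\<^esub> d"] H.hom_inv[of d] by (simp add: A.minus_eq a_inv_def)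
    finally show ?thesis .
  qed
  have Frag: "frag_of p \<in> carrier ?F" if "p \<in> ?S" for p using that by auto
  have Fd: "c - d \<in> carrier ?F" if "c \<in> carrier ?F" "d \<in> carrier ?F" for c d
    using that keys_diff[of c d] by fastforce
  have Hdiff2: "c - d - e \<in> carrier ?F \<and> H (c - d - e) = H c \<ominus> H d \<ominus> H e"
    if "c \<in> carrier ?F" "d \<in> carrier ?F" "e \<in> carrier ?F" for c d e
    using Hdiff[OF Fd[OF that(1,2)] that(3)] Hdiff[OF that(1,2)] Fd[OF Fd[OF that(1,2)] that(3)] by (simp del: carrier_free_Abelian_group_iff)
  have cancel: "(p \<oplus> q) \<ominus> p \<ominus> q = \<zero>" if "p \<in> carrier A" "q \<in> carrier A" for p q
  proof -
    have "(p \<oplus> q) \<ominus> p = q"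
      using that by (simp add: A.minus_eq A.a_comm[of p q] A.a_assoc A.r_neg)
    thus ?thesis using that by (simp add: A.minus_eq A.r_neg)
  qed
  have rel: "tensor_relators R M N \<subseteq> kernel ?F (add_monoid A) H"
  proof
    fix c assume "c \<in> tensor_relators R M N"
    then consider (l) x x' y where "x \<in> carrier M" "x' \<in> carrier M" "y \<in> carrier N"
        "c = frag_of (x \<oplus>\<^bsub>M\<^esub> x', y) - frag_of (x, y) - frag_of (x', y)"
      | (r) x y y' where "x \<in> carrier M" "y \<in> carrier N" "y' \<in> carrier N"
        "c = frag_of (x, y \<oplus>\<^bsub>N\<^esub> y') - frag_of (x, y) - frag_of (x, y')"
      | (m) x a y where "x \<in> carrier M" "a \<in> carrier R" "y \<in> carrier N"
        "c = frag_of (x \<triangleleft>\<^bsub>M\<^esub> a, y) - frag_of (x, a \<odot>\<^bsub>N\<^esub> y)"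
      unfolding tensor_relators_def by (elim UnE CollectE exE conjE) iprover+
    thus "c \<in> kernel ?F (add_monoid A) H"
    proof cases
      case l
      have S: "(x \<oplus>\<^bsub>M\<^esub> x', y) \<in> ?S" "(x, y) \<in> ?S" "(x', y) \<in> ?S" using l by auto
      show ?thesis unfolding l(4) kernel_def
        using Hdiff2[OF S[THEN Frag]] addl[OF l(1-3)] cancel[of "\<beta> x y" "\<beta> x' y"] closed l(1-3)
        unfolding S[THEN Hof] b_def fst_conv snd_conv by (auto simp del: carrier_free_Abelian_group_iff)
    next
      case r
      have S: "(x, y \<oplus>\<^bsub>N\<^esub> y') \<in> ?S" "(x, y) \<in> ?S" "(x, y') \<in> ?S" using r by auto
      show ?thesis unfolding r(4) kernel_def
        using Hdiff2[OF S[THEN Frag]] addr[OF r(1-3)] cancel[of "\<beta> x y" "\<beta> x y'"] closed r(1-3)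
        unfolding S[THEN Hof] b_def fst_conv snd_conv by (auto simp del: carrier_free_Abelian_group_iff)
    next
      case m
      have S: "(x \<triangleleft>\<^bsub>M\<^esub> a, y) \<in> ?S" "(x, a \<odot>\<^bsub>N\<^esub> y) \<in> ?S"
        using m M.rsmult_closed N.lsmult_closed by auto
      have "\<beta> x (a \<odot>\<^bsub>N\<^esub> y) \<in> carrier A" using closed S by auto
      thus ?thesis unfolding m(4) kernel_def
        using Hdiff[OF S[THEN Frag]] Fd[OF S[THEN Frag]] bal[OF m(1-3)]
        unfolding S[THEN Hof] b_def fst_conv snd_conv
        by (simp add: A.minus_eq A.r_neg del: carrier_free_Abelian_group_iff)
    qed
  qed
  have ker: "tensor_kernel R M N \<subseteq> kernel ?F (add_monoid A) H"
    unfolding tensor_kernel_def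
    by (rule group.generate_subgroup_incl[OF _ rel H.subgroup_kernel]) simp
  have one: "\<one>\<^bsub>?F\<^esub> \<in> tensor_kernel R M N" unfolding tensor_kernel_def by (rule generate.one)
  have p: "(x, y) \<in> ?S" using xy by simp
  have "H ` tensor R M N x y = {b (x, y)}"
  proof -
    have "H (k + frag_of (x, y)) = b (x, y)" if "k \<in> tensor_kernel R M N" for k
    proof -
      have k: "k \<in> carrier ?F" "H k = \<zero>" using ker that by (auto simp: kernel_def)
      thus ?thesis using H.hom_mult[OF k(1) Frag[OF p]] b[OF p] Hof[OF p] by simp
    qed
    moreover have "tensor R M N x y = (\<lambda>k. k + frag_of (x, y)) ` tensor_kernel R M N"
      by (auto simp: tensor_def tensor_class_def r_coset_def)
    ultimately have "H ` tensor R M N x y = (\<lambda>_. b (x, y)) ` tensor_kernel R M N"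
      by (simp add: image_image)
    thus ?thesis using one by auto
  qed
  thus ?thesis by (simp add: tensor_lift_def H_def[abs_def] b_def)
qed

section \<open>\<open>\<theta>\<close>-extensions\<close>

locale theta_datum = bimodule R M for R (structure) and M (structure) and \<theta> +
  assumes theta_hom: "\<theta> \<in> bimodule_hom R (tensor_product R M M) M"
    and theta_assoc:
      "\<lbrakk>x \<in> carrier M; y \<in> carrier M; z \<in> carrier M\<rbrakk> \<Longrightarrow>
        \<theta> (tensor R M M (\<theta> (tensor R M M x y)) z) = \<theta> (tensor R M M x (\<theta> (tensor R M M y z)))"

definition theta_extension ::
  "('a, 'c) ring_scheme \<Rightarrow> ('a, 'm, 'd) bimodule_scheme
    \<Rightarrow> (('m \<times> 'm \<Rightarrow>\<^sub>0 int) set \<Rightarrow> 'm) \<Rightarrow> ('a \<times> 'm) ring" where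
  "theta_extension R M \<theta> =
     \<lparr>carrier = carrier R \<times> carrier M,
      monoid.mult = (\<lambda>(a, x) (b, y).
                (a \<otimes>\<^bsub>R\<^esub> b, a \<odot>\<^bsub>M\<^esub> y \<oplus>\<^bsub>M\<^esub> x \<triangleleft>\<^bsub>M\<^esub> b \<oplus>\<^bsub>M\<^esub> \<theta> (tensor R M M x y))),
      one = (\<one>\<^bsub>R\<^esub>, \<zero>\<^bsub>M\<^esub>),
      ring.zero = (\<zero>\<^bsub>R\<^esub>, \<zero>\<^bsub>M\<^esub>),
      add = (\<lambda>(a, x) (b, y). (a \<oplus>\<^bsub>R\<^esub> b, x \<oplus>\<^bsub>M\<^esub> y))\<rparr>"

section \<open>Group actions\<close>

locale ring_action = group_action G "carrier R" \<phi> + R?: ring R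
  for G (structure) and R (structure) and \<phi> +
  assumes action_ring_iso: "g \<in> carrier G \<Longrightarrow> \<phi> g \<in> ring_iso R R"

locale equivariant_theta_datum =
  theta_datum R M \<theta> + R_act: ring_action G R \<phi> + M_act: group_action G "carrier M" \<psi>
  for G (structure) and R (structure) and \<phi> and M (structure) and \<psi> and \<theta> +
  assumes M_act_add:
      "\<lbrakk>g \<in> carrier G; x \<in> carrier M; y \<in> carrier M\<rbrakk> \<Longrightarrow>
        \<psi> g (x \<oplus>\<^bsub>M\<^esub> y) = \<psi> g x \<oplus>\<^bsub>M\<^esub> \<psi> g y"
    and M_act_smult:
      "\<lbrakk>g \<in> carrier G; a \<in> carrier R; x \<in> carrier M; b \<in> carrier R\<rbrakk> \<Longrightarrow>
        \<psi> g ((a \<odot>\<^bsub>M\<^esub> x) \<triangleleft>\<^bsub>M\<^esub> b) = (\<phi> g a \<odot>\<^bsub>M\<^esub> \<psi> g x) \<triangleleft>\<^bsub>M\<^esub> \<phi> g b"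
    and M_act_theta:
      "\<lbrakk>g \<in> carrier G; x \<in> carrier M; y \<in> carrier M\<rbrakk> \<Longrightarrow>
        \<psi> g (\<theta> (tensor R M M x y)) = \<theta> (tensor R M M (\<psi> g x) (\<psi> g y))"

text \<open>\<open>group_action\<close> demands that every group element act by an extensional function, hence
  the restriction.\<close>

definition extension_action ::
  "('a, 'c) ring_scheme \<Rightarrow> ('a, 'm, 'd) bimodule_scheme \<Rightarrow> ('g \<Rightarrow> 'a \<Rightarrow> 'a) \<Rightarrow> ('g \<Rightarrow> 'm \<Rightarrow> 'm)
    \<Rightarrow> 'g \<Rightarrow> 'a \<times> 'm \<Rightarrow> 'a \<times> 'm" where
  "extension_action R M \<phi> \<psi> g = (\<lambda>(a, x) \<in> carrier R \<times> carrier M. (\<phi> g a, \<psi> g x))"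

section \<open>Skew group rings and induced bimodules\<close>

text \<open>The formal sum \<open>\<Sum>\<^sub>g a\<^sub>g # g\<close> is the finitely supported coefficient function \<open>g \<mapsto> a\<^sub>g\<close>.\<close>

definition coeff_support ::
  "('g, 'c) monoid_scheme \<Rightarrow> ('a, 'd) ring_scheme \<Rightarrow> ('g \<Rightarrow> 'a) \<Rightarrow> 'g set" where
  "coeff_support G A u = {g \<in> carrier G. u g \<noteq> \<zero>\<^bsub>A\<^esub>}"

definition formal_sums ::
  "('g, 'c) monoid_scheme \<Rightarrow> ('a, 'd) ring_scheme \<Rightarrow> ('g \<Rightarrow> 'a) set" where
  "formal_sums G A = {u \<in> carrier G \<rightarrow>\<^sub>E carrier A. finite (coeff_support G A u)}"

definition monomial ::
  "('g, 'c) monoid_scheme \<Rightarrow> ('a, 'd) ring_scheme \<Rightarrow> 'a \<Rightarrow> 'g \<Rightarrow> 'g \<Rightarrow> 'a" where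
  "monomial G A a g = (\<lambda>k \<in> carrier G. if k = g then a else \<zero>\<^bsub>A\<^esub>)"

text \<open>The biadditive extension of \<open>(a # g, b # h) \<mapsto> \<beta> g a h b # gh\<close>, with \<open>a \<in> A\<close>, \<open>b \<in> B\<close>
  and values of \<open>\<beta>\<close> in \<open>C\<close>. All products of formal sums below are of this form.\<close>

definition graded_product ::
  "('g, 'x) monoid_scheme \<Rightarrow> ('a, 'y) ring_scheme \<Rightarrow> ('b, 'z) ring_scheme \<Rightarrow> ('c, 'w) ring_scheme
    \<Rightarrow> ('g \<Rightarrow> 'a \<Rightarrow> 'g \<Rightarrow> 'b \<Rightarrow> 'c) \<Rightarrow> ('g \<Rightarrow> 'a) \<Rightarrow> ('g \<Rightarrow> 'b) \<Rightarrow> 'g \<Rightarrow> 'c" where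
  "graded_product G A B C \<beta> u v =
     (\<lambda>k \<in> carrier G.
        \<Oplus>\<^bsub>C\<^esub>p \<in> {p \<in> coeff_support G A u \<times> coeff_support G B v. fst p \<otimes>\<^bsub>G\<^esub> snd p = k}.
          \<beta> (fst p) (u (fst p)) (snd p) (v (snd p)))"

definition skew_group_ring ::
  "('a, 'y) ring_scheme \<Rightarrow> ('g, 'x) monoid_scheme \<Rightarrow> ('g \<Rightarrow> 'a \<Rightarrow> 'a) \<Rightarrow> ('g \<Rightarrow> 'a) ring" where
  "skew_group_ring R G \<phi> =
     \<lparr>carrier = formal_sums G R,
      monoid.mult = graded_product G R R R (\<lambda>g a h b. a \<otimes>\<^bsub>R\<^esub> \<phi> g b),
      one = monomial G R \<one>\<^bsub>R\<^esub> \<one>\<^bsub>G\<^esub>,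
      ring.zero = (\<lambda>g \<in> carrier G. \<zero>\<^bsub>R\<^esub>),
      add = (\<lambda>u v. \<lambda>g \<in> carrier G. u g \<oplus>\<^bsub>R\<^esub> v g)\<rparr>"

definition induced_bimodule ::
  "('a, 'y) ring_scheme \<Rightarrow> ('a, 'm, 'z) bimodule_scheme \<Rightarrow> ('g, 'x) monoid_scheme
    \<Rightarrow> ('g \<Rightarrow> 'a \<Rightarrow> 'a) \<Rightarrow> ('g \<Rightarrow> 'm \<Rightarrow> 'm) \<Rightarrow> ('g \<Rightarrow> 'a, 'g \<Rightarrow> 'm) bimodule" where
  "induced_bimodule R M G \<phi> \<psi> =
     \<lparr>carrier = formal_sums G M, monoid.mult = undefined, one = undefined,
      ring.zero = (\<lambda>g \<in> carrier G. \<zero>\<^bsub>M\<^esub>),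
      add = (\<lambda>u v. \<lambda>g \<in> carrier G. u g \<oplus>\<^bsub>M\<^esub> v g),
      smult = graded_product G R M M (\<lambda>g a h x. a \<odot>\<^bsub>M\<^esub> \<psi> g x),
      rsmult = graded_product G M R M (\<lambda>h x g b. x \<triangleleft>\<^bsub>M\<^esub> \<phi> h b)\<rparr>"

definition induced_theta ::
  "('a, 'y) ring_scheme \<Rightarrow> ('a, 'm, 'z) bimodule_scheme \<Rightarrow> ('g, 'x) monoid_scheme
    \<Rightarrow> ('g \<Rightarrow> 'a \<Rightarrow> 'a) \<Rightarrow> ('g \<Rightarrow> 'm \<Rightarrow> 'm) \<Rightarrow> (('m \<times> 'm \<Rightarrow>\<^sub>0 int) set \<Rightarrow> 'm)
    \<Rightarrow> (('g \<Rightarrow> 'm) \<times> ('g \<Rightarrow> 'm) \<Rightarrow>\<^sub>0 int) set \<Rightarrow> 'g \<Rightarrow> 'm" where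
  "induced_theta R M G \<phi> \<psi> \<theta> =
     tensor_lift (induced_bimodule R M G \<phi> \<psi>)
       (graded_product G M M M (\<lambda>g x h y. \<theta> (tensor R M M x (\<psi> g y))))"

end

theory Submission
  imports Defs
begin

text \<open>
  Splitting coefficients, \<open>\<Sum>\<^sub>g (a\<^sub>g, x\<^sub>g) # g \<mapsto> (\<Sum>\<^sub>g a\<^sub>g # g, \<Sum>\<^sub>g x\<^sub>g # g)\<close>, is an additive bijection; it is
  multiplicative because the product \<open>(a, x) (g(b), g(y))\<close> in \<open>\<Lambda>\<close> has module component
  \<open>a g(y) + x g(b) + \<theta>(x \<otimes> g(y))\<close>, whose three terms are those of the left action, the right action and the
  induced homomorphism. All products of formal sums are biadditive and graded, so that
  associativity of each of them, the bimodule laws and the balancedness of the induced pairing reduce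
  to identities between homogeneous elements.
\<close>

section \<open>Finite sums in abelian groups\<close>

text \<open>Exchanges the two convolution sums in the associativity proof for graded
  products.\<close>

lemma (in abelian_monoid) finsum_swap:
  assumes "finite I" "finite J" "\<And>i j. \<lbrakk>i \<in> I; j \<in> J\<rbrakk> \<Longrightarrow> f i j \<in> carrier G"
  shows "(\<Oplus>i\<in>I. \<Oplus>j\<in>J. f i j) = (\<Oplus>j\<in>J. \<Oplus>i\<in>I. f i j)"
  using assms(1,3)
proof (induction I rule: finite_induct)
  case empty
  then show ?case by simp
next
  case (insert a I)
  have "(\<Oplus>i\<in>insert a I. \<Oplus>j\<in>J. f i j) = (\<Oplus>j\<in>J. f a j) \<oplus> (\<Oplus>j\<in>J. \<Oplus>i\<in>I. f i j)"
    using insert by (subst finsum_insert) (auto intro!: finsum_closed simp: Pi_def)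
  also have "\<dots> = (\<Oplus>j\<in>J. f a j \<oplus> (\<Oplus>i\<in>I. f i j))"
    using insert by (subst finsum_addf) (auto intro!: finsum_closed simp: Pi_def)
  also have "\<dots> = (\<Oplus>j\<in>J. \<Oplus>i\<in>insert a I. f i j)"
    using insert by (intro finsum_cong') (auto intro!: finsum_closed simp: Pi_def)
  finally show ?case .
qed

text \<open>Additivity forces zero to go to zero, by cancellation, and induction does the rest; over
  an infinite index set both sums are zero by convention. The instance with empty index set serves
  below to show that additive maps preserve zero.\<close>

lemma additive_finsum:
  assumes "abelian_group A" "abelian_group B"
    and closed: "\<And>x. x \<in> carrier A \<Longrightarrow> h x \<in> carrier B"
    and add: "\<And>x y. \<lbrakk>x \<in> carrier A; y \<in> carrier A\<rbrakk> \<Longrightarrow> h (x \<oplus>\<^bsub>A\<^esub> y) = h x \<oplus>\<^bsub>B\<^esub> h y"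
    and f: "\<And>i. i \<in> I \<Longrightarrow> f i \<in> carrier A"
  shows "h (\<Oplus>\<^bsub>A\<^esub>i\<in>I. f i) = (\<Oplus>\<^bsub>B\<^esub>i\<in>I. h (f i))"
proof -
  interpret A: abelian_group A by fact
  interpret B: abelian_group B by fact
  have "h \<zero>\<^bsub>A\<^esub> \<oplus>\<^bsub>B\<^esub> h \<zero>\<^bsub>A\<^esub> = h \<zero>\<^bsub>A\<^esub> \<oplus>\<^bsub>B\<^esub> \<zero>\<^bsub>B\<^esub>"
    using add[of "\<zero>\<^bsub>A\<^esub>" "\<zero>\<^bsub>A\<^esub>"] closed by simp
  hence zero: "h \<zero>\<^bsub>A\<^esub> = \<zero>\<^bsub>B\<^esub>" using closed by simp
  show ?thesis using f
  proof (induction I rule: infinite_finite_induct)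
    case (insert i I)
    then show ?case
      by (subst A.finsum_insert) (auto simp: add closed Pi_def)
  qed (simp_all add: zero)
qed

section \<open>Graded products over a finite group\<close>

text \<open>Supports lie inside the finite carrier of \<open>G\<close>, hence are finite. Membership
  of a formal sum thus becomes a pointwise condition together with extensionality.\<close>

lemma formal_sums_finite:
  "finite (carrier G) \<Longrightarrow> formal_sums G A = carrier G \<rightarrow>\<^sub>E carrier A"
  by (simp add: formal_sums_def coeff_support_def)

text \<open>Stated for any record \<open>S\<close> with pointwise zero and addition, so that it
  applies both to the skew group ring and to the induced bimodule, whose record types
  differ.\<close>

lemma abelian_group_formal_sums:
  assumes "abelian_group A" "finite (carrier G)"
    and S: "carrier S = formal_sums G A" "ring.zero S = (\<lambda>g\<in>carrier G. \<zero>\<^bsub>A\<^esub>)"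
      "add S = (\<lambda>u v. \<lambda>g\<in>carrier G. u g \<oplus>\<^bsub>A\<^esub> v g)"
  shows "abelian_group S"
proof -
  interpret A: abelian_group A by fact
  have app: "u g \<in> carrier A" if "u \<in> carrier S" "g \<in> carrier G" for u g
    using that by (auto simp: S formal_sums_finite assms(2))
  show ?thesis
  proof (rule abelian_groupI)
    fix u assume u: "u \<in> carrier S"
    have "(\<lambda>g\<in>carrier G. \<ominus>\<^bsub>A\<^esub> u g) \<in> carrier S"
      using app[OF u] by (auto simp: S formal_sums_finite assms(2))
    moreover have "(\<lambda>g\<in>carrier G. \<ominus>\<^bsub>A\<^esub> u g) \<oplus>\<^bsub>S\<^esub> u = \<zero>\<^bsub>S\<^esub>"
      using app[OF u] by (auto simp: S A.l_neg intro!: restrict_ext)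
    ultimately show "\<exists>v\<in>carrier S. v \<oplus>\<^bsub>S\<^esub> u = \<zero>\<^bsub>S\<^esub>" by blast
    show "\<zero>\<^bsub>S\<^esub> \<oplus>\<^bsub>S\<^esub> u = u"
    proof
      fix g show "(\<zero>\<^bsub>S\<^esub> \<oplus>\<^bsub>S\<^esub> u) g = u g"
        \<comment> \<open>Off \<open>carrier G\<close> both functions take the value
          \<open>undefined\<close>, by extensionality of \<open>u\<close>.\<close>
        using app[OF u, of g] u PiE_arb[of u "carrier G" "\<lambda>_. carrier A" g]
        by (cases "g \<in> carrier G") (simp_all add: S formal_sums_finite assms(2))
    qed
  next
    fix u v assume "u \<in> carrier S" "v \<in> carrier S"
    thus "u \<oplus>\<^bsub>S\<^esub> v \<in> carrier S" "u \<oplus>\<^bsub>S\<^esub> v = v \<oplus>\<^bsub>S\<^esub> u"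
      using app by (auto simp: S formal_sums_finite assms(2) A.a_comm simp del: PiE_mem intro!: restrict_ext)
  next
    fix u v w assume "u \<in> carrier S" "v \<in> carrier S" "w \<in> carrier S"
    thus "u \<oplus>\<^bsub>S\<^esub> v \<oplus>\<^bsub>S\<^esub> w = u \<oplus>\<^bsub>S\<^esub> (v \<oplus>\<^bsub>S\<^esub> w)"
      using app by (auto simp: S(3) A.a_assoc intro!: restrict_ext)
  next
    show "\<zero>\<^bsub>S\<^esub> \<in> carrier S" by (auto simp: S formal_sums_finite assms(2))
  qed
qed

text \<open>The degrees are arguments of \<beta> because the action twists the second coefficient by
  the degree of the first. Three separate coefficient groups make ring products, both module actions
  and the pairing by \<theta> instances of one notion.\<close>

locale graded_pairing =
  group G + A: abelian_group A + B: abelian_group B + C: abelian_group C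
  for G (structure) and A and B and C and \<beta> +
  assumes finite_group: "finite (carrier G)"
    and pair_closed: "\<lbrakk>g \<in> carrier G; h \<in> carrier G; a \<in> carrier A; b \<in> carrier B\<rbrakk> \<Longrightarrow>
      \<beta> g a h b \<in> carrier C"
    and pair_add_left: "\<lbrakk>g \<in> carrier G; h \<in> carrier G; a \<in> carrier A; a' \<in> carrier A; b \<in> carrier B\<rbrakk> \<Longrightarrow>
      \<beta> g (a \<oplus>\<^bsub>A\<^esub> a') h b = \<beta> g a h b \<oplus>\<^bsub>C\<^esub> \<beta> g a' h b"
    and pair_add_right: "\<lbrakk>g \<in> carrier G; h \<in> carrier G; a \<in> carrier A; b \<in> carrier B; b' \<in> carrier B\<rbrakk> \<Longrightarrow>
      \<beta> g a h (b \<oplus>\<^bsub>B\<^esub> b') = \<beta> g a h b \<oplus>\<^bsub>C\<^esub> \<beta> g a h b'"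
begin

section \<open>Convolution formula and biadditivity of graded products\<close>

lemma formal_sums_app:
  "u \<in> formal_sums G S \<Longrightarrow> g \<in> carrier G \<Longrightarrow> u g \<in> carrier S"
  by (auto simp: formal_sums_def)

lemma pair_zero_left:
  assumes "g \<in> carrier G" "h \<in> carrier G" "b \<in> carrier B"
  shows "\<beta> g \<zero>\<^bsub>A\<^esub> h b = \<zero>\<^bsub>C\<^esub>"
  \<comment> \<open>The empty sum expresses zero; \<open>undefined\<close> fills the place of the
    family of summands.\<close>
  using additive_finsum[of A C "\<lambda>a. \<beta> g a h b" "{}" undefined] assms pair_closed pair_add_left
  by (simp add: A.abelian_group_axioms C.abelian_group_axioms)

lemma pair_zero_right:
  assumes "g \<in> carrier G" "h \<in> carrier G" "a \<in> carrier A"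
  shows "\<beta> g a h \<zero>\<^bsub>B\<^esub> = \<zero>\<^bsub>C\<^esub>"
  using additive_finsum[of B C "\<lambda>b. \<beta> g a h b" "{}" undefined] assms pair_closed pair_add_right
  by (simp add: B.abelian_group_axioms C.abelian_group_axioms)

text \<open>A pair of degrees with product \<open>k\<close> is determined by its first entry
  \<open>g\<close>, the second being \<open>inv g \<otimes> k\<close>. Summing over all of
  \<open>G\<close> instead of the supports gives an index set independent of \<open>u\<close> and
  \<open>v\<close>, which is what later manipulations of sums rely on.\<close>

lemma graded_product_app:
  assumes u: "u \<in> formal_sums G A" and v: "v \<in> formal_sums G B" and k: "k \<in> carrier G"
  shows "graded_product G A B C \<beta> u v k =
    (\<Oplus>\<^bsub>C\<^esub>g\<in>carrier G. \<beta> g (u g) (inv g \<otimes> k) (v (inv g \<otimes> k)))"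
proof -
  let ?s = "\<lambda>g. (g, inv g \<otimes> k)"
  let ?f = "\<lambda>p. \<beta> (fst p) (u (fst p)) (snd p) (v (snd p))"
  let ?P = "{p \<in> coeff_support G A u \<times> coeff_support G B v. fst p \<otimes> snd p = k}"
  have uv: "\<And>g. g \<in> carrier G \<Longrightarrow> u g \<in> carrier A" "\<And>g. g \<in> carrier G \<Longrightarrow> v g \<in> carrier B"
    using u v formal_sums_app by auto
  have sub: "?P \<subseteq> ?s ` carrier G"
  proof
    fix p assume "p \<in> ?P"
    hence "p = ?s (fst p)" "fst p \<in> carrier G"
      using k by (auto simp: coeff_support_def prod_eq_iff inv_solve_left)
    thus "p \<in> ?s ` carrier G" by blast
  qed
  have "(\<Oplus>\<^bsub>C\<^esub>p\<in>?P. ?f p) = (\<Oplus>\<^bsub>C\<^esub>p\<in>?s ` carrier G. ?f p)"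
  \<comment> \<open>The added pairs have a zero coefficient in one of the two factors, so \<beta>
    vanishes on them.\<close>
  proof (rule C.add.finprod_mono_neutral_cong_left[OF _ sub])
    fix p assume p: "p \<in> ?s ` carrier G - ?P"
    then obtain g where g: "g \<in> carrier G" "p = ?s g" by blast
    hence "u g = \<zero>\<^bsub>A\<^esub> \<or> v (inv g \<otimes> k) = \<zero>\<^bsub>B\<^esub>"
      using p k by (auto simp: coeff_support_def m_assoc[symmetric])
    thus "?f p = \<zero>\<^bsub>C\<^esub>"
      using g k uv pair_zero_left pair_zero_right by auto
  qed (use finite_group k uv pair_closed in auto)
  also have "\<dots> = (\<Oplus>\<^bsub>C\<^esub>g\<in>carrier G. ?f (?s g))"
  proof (rule C.finsum_reindex)
    show "?f \<in> ?s ` carrier G \<rightarrow> carrier C" using k uv pair_closed by auto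
  qed (rule inj_onI, simp)
  finally show ?thesis using k by (simp add: graded_product_def)
qed

lemma graded_product_closed:
  assumes "u \<in> formal_sums G A" "v \<in> formal_sums G B"
  shows "graded_product G A B C \<beta> u v \<in> formal_sums G C"
proof -
  have "graded_product G A B C \<beta> u v k \<in> carrier C" if "k \<in> carrier G" for k
    using that assms pair_closed
    by (auto simp: graded_product_app formal_sums_app intro!: C.finsum_closed)
  thus ?thesis
    by (auto simp: formal_sums_finite finite_group graded_product_def)
qed

text \<open>Both functions are extensional, so agreement on group elements suffices.\<close>

lemma graded_product_eqI:
  assumes "w \<in> formal_sums G C"
    and "\<And>k. k \<in> carrier G \<Longrightarrow> graded_product G A B C \<beta> u v k = w k"
  shows "graded_product G A B C \<beta> u v = w"
  using assms
  by (auto simp: formal_sums_finite finite_group graded_product_def intro!: ext)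

text \<open>The supports of \<open>u\<close>, \<open>u'\<close> and their sum may differ, but the
  convolution formula puts all three products over the same index set, where additivity applies
  termwise.\<close>

lemma graded_product_add_left:
  assumes "u \<in> formal_sums G A" "u' \<in> formal_sums G A" "v \<in> formal_sums G B"
  shows "graded_product G A B C \<beta> (\<lambda>g\<in>carrier G. u g \<oplus>\<^bsub>A\<^esub> u' g) v =
    (\<lambda>g\<in>carrier G. graded_product G A B C \<beta> u v g \<oplus>\<^bsub>C\<^esub> graded_product G A B C \<beta> u' v g)"
    (is "?l = ?r")
proof (rule graded_product_eqI)
  note closed = assms[THEN formal_sums_app] pair_closed
  show "?r \<in> formal_sums G C"
    using assms graded_product_closed[THEN formal_sums_app]
    by (auto simp: formal_sums_finite[OF finite_group])
  have add: "(\<lambda>g\<in>carrier G. u g \<oplus>\<^bsub>A\<^esub> u' g) \<in> formal_sums G A"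
    using assms by (auto simp: formal_sums_finite finite_group)
  fix k assume k: "k \<in> carrier G"
  have "?l k = (\<Oplus>\<^bsub>C\<^esub>g\<in>carrier G. \<beta> g (u g) (inv g \<otimes> k) (v (inv g \<otimes> k)) \<oplus>\<^bsub>C\<^esub>
      \<beta> g (u' g) (inv g \<otimes> k) (v (inv g \<otimes> k)))"
    unfolding graded_product_app[OF add assms(3) k]
    by (rule C.finsum_cong') (use k closed in \<open>auto simp: pair_add_left\<close>)
  thus "?l k = ?r k"
    using k closed assms by (simp add: graded_product_app C.finsum_addf Pi_def)
qed

lemma graded_product_add_right:
  assumes "u \<in> formal_sums G A" "v \<in> formal_sums G B" "v' \<in> formal_sums G B"
  shows "graded_product G A B C \<beta> u (\<lambda>g\<in>carrier G. v g \<oplus>\<^bsub>B\<^esub> v' g) =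
    (\<lambda>g\<in>carrier G. graded_product G A B C \<beta> u v g \<oplus>\<^bsub>C\<^esub> graded_product G A B C \<beta> u v' g)"
    (is "?l = ?r")
proof (rule graded_product_eqI)
  note closed = assms[THEN formal_sums_app] pair_closed
  show "?r \<in> formal_sums G C"
    using assms graded_product_closed[THEN formal_sums_app]
    by (auto simp: formal_sums_finite[OF finite_group])
  have add: "(\<lambda>g\<in>carrier G. v g \<oplus>\<^bsub>B\<^esub> v' g) \<in> formal_sums G B"
    using assms by (auto simp: formal_sums_finite finite_group)
  fix k assume k: "k \<in> carrier G"
  have "?l k = (\<Oplus>\<^bsub>C\<^esub>g\<in>carrier G. \<beta> g (u g) (inv g \<otimes> k) (v (inv g \<otimes> k)) \<oplus>\<^bsub>C\<^esub>
      \<beta> g (u g) (inv g \<otimes> k) (v' (inv g \<otimes> k)))"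
    unfolding graded_product_app[OF assms(1) add k]
    by (rule C.finsum_cong') (use k closed in \<open>auto simp: pair_add_right\<close>)
  thus "?l k = ?r k"
    using k closed assms by (simp add: graded_product_app C.finsum_addf Pi_def)
qed

end

section \<open>Unit laws for graded products\<close>

lemma graded_product_unit_left:
  fixes G (structure)
  assumes "graded_pairing G A B B \<beta>"
    and e: "e \<in> carrier A" and v: "v \<in> formal_sums G B"
    and unit: "\<And>h b. \<lbrakk>h \<in> carrier G; b \<in> carrier B\<rbrakk> \<Longrightarrow> \<beta> \<one> e h b = b"
  shows "graded_product G A B B \<beta> (monomial G A e \<one>) v = v"
proof -
  interpret graded_pairing G A B B \<beta> by fact
  have mono: "monomial G A e \<one> \<in> formal_sums G A"
    using e by (auto simp: formal_sums_finite finite_group monomial_def)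
  show ?thesis
  proof (rule graded_product_eqI[OF v])
    fix k assume k: "k \<in> carrier G"
    \<comment> \<open>Only the summand at the identity survives; the conditional has the shape that
      \<open>finsum_singleton\<close> expects.\<close>
    have "graded_product G A B B \<beta> (monomial G A e \<one>) v k =
        (\<Oplus>\<^bsub>B\<^esub>g\<in>carrier G. if \<one> = g then v k else \<zero>\<^bsub>B\<^esub>)"
      unfolding graded_product_app[OF mono v k]
      by (rule B.finsum_cong')
        (use k v in \<open>auto simp: monomial_def unit pair_zero_left formal_sums_app\<close>)
    also have "\<dots> = v k"
      by (rule B.finsum_singleton) (use k v finite_group in \<open>auto simp: formal_sums_app\<close>)
    finally show "graded_product G A B B \<beta> (monomial G A e \<one>) v k = v k" .
  qed
qed

lemma graded_product_unit_right:
  fixes G (structure)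
  assumes "graded_pairing G A B A \<beta>"
    and e: "e \<in> carrier B" and u: "u \<in> formal_sums G A"
    and unit: "\<And>g a. \<lbrakk>g \<in> carrier G; a \<in> carrier A\<rbrakk> \<Longrightarrow> \<beta> g a \<one> e = a"
  shows "graded_product G A B A \<beta> u (monomial G B e \<one>) = u"
proof -
  interpret graded_pairing G A B A \<beta> by fact
  have mono: "monomial G B e \<one> \<in> formal_sums G B"
    using e by (auto simp: formal_sums_finite finite_group monomial_def)
  show ?thesis
  proof (rule graded_product_eqI[OF u])
    fix k assume k: "k \<in> carrier G"
    \<comment> \<open>Now the monomial is the second factor, so the surviving summand is the one at
      \<open>g = k\<close>.\<close>
    have inv_eq: "inv g \<otimes> k = \<one> \<longleftrightarrow> k = g" if "g \<in> carrier G" for g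
      using that k by (metis inv_closed inv_equality inv_inv l_inv)
    have "graded_product G A B A \<beta> u (monomial G B e \<one>) k =
        (\<Oplus>\<^bsub>A\<^esub>g\<in>carrier G. if k = g then u g else \<zero>\<^bsub>A\<^esub>)"
      unfolding graded_product_app[OF u mono k]
      by (rule A.finsum_cong')
        (use k u in \<open>auto simp: monomial_def unit inv_eq pair_zero_right formal_sums_app\<close>)
    also have "\<dots> = u k"
      by (rule A.finsum_singleton) (use k u finite_group in \<open>auto simp: formal_sums_app\<close>)
    finally show "graded_product G A B A \<beta> u (monomial G B e \<one>) k = u k" .
  qed
qed

text \<open>Both sides expand by the convolution formula into double sums; swapping the sums and
  translating one summation variable reduces the claim to the identity between homogeneous elements.
  Four different pairings are allowed so that ring associativity, the three mixed bimodule laws and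
  balancedness of the induced pairing all follow from this one lemma.\<close>

lemma graded_product_assoc:
  fixes G (structure)
  assumes "graded_pairing G A B D \<beta>" "graded_pairing G D C E \<gamma>"
    and "graded_pairing G B C F \<beta>'" "graded_pairing G A F E \<gamma>'"
    and assoc: "\<And>g a h b k c. \<lbrakk>g \<in> carrier G; h \<in> carrier G; k \<in> carrier G;
        a \<in> carrier A; b \<in> carrier B; c \<in> carrier C\<rbrakk> \<Longrightarrow>
        \<gamma> (g \<otimes> h) (\<beta> g a h b) k c = \<gamma>' g a (h \<otimes> k) (\<beta>' h b k c)"
    and u: "u \<in> formal_sums G A" and v: "v \<in> formal_sums G B" and w: "w \<in> formal_sums G C"
  shows "graded_product G D C E \<gamma> (graded_product G A B D \<beta> u v) w =
    graded_product G A F E \<gamma>' u (graded_product G B C F \<beta>' v w)"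
proof -
  interpret D: abelian_group D using assms(1) by (simp add: graded_pairing_def)
  interpret E: abelian_group E using assms(2) by (simp add: graded_pairing_def)
  interpret F: abelian_group F using assms(3) by (simp add: graded_pairing_def)
  interpret ABD: graded_pairing G A B D \<beta> by fact
  interpret DCE: graded_pairing G D C E \<gamma> by fact
  interpret BCF: graded_pairing G B C F \<beta>' by fact
  interpret AFE: graded_pairing G A F E \<gamma>' by fact
  note app = u[THEN ABD.formal_sums_app] v[THEN ABD.formal_sums_app] w[THEN ABD.formal_sums_app]
  note closed = ABD.pair_closed DCE.pair_closed BCF.pair_closed AFE.pair_closed
  note fin = ABD.finite_group
  have uv: "graded_product G A B D \<beta> u v \<in> formal_sums G D"
    using u v by (rule ABD.graded_product_closed)
  have vw: "graded_product G B C F \<beta>' v w \<in> formal_sums G F"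
    using v w by (rule BCF.graded_product_closed)
  show ?thesis
  proof (rule DCE.graded_product_eqI)
    fix k assume k: "k \<in> carrier G"
    \<comment> \<open>Here \<open>h\<close> is the degree taken from \<open>u\<close> and
      \<open>g\<close> the degree of the product of \<open>u\<close> and \<open>v\<close>.\<close>
    define t where "t g h = \<gamma> g (\<beta> h (u h) (inv h \<otimes> g) (v (inv h \<otimes> g)))
      (inv g \<otimes> k) (w (inv g \<otimes> k))" for g h
    have t: "t g h \<in> carrier E" if "g \<in> carrier G" "h \<in> carrier G" for g h
      using that k by (auto simp: t_def intro!: closed app)
    have "graded_product G D C E \<gamma> (graded_product G A B D \<beta> u v) w k =
        (\<Oplus>\<^bsub>E\<^esub>g\<in>carrier G. \<Oplus>\<^bsub>E\<^esub>h\<in>carrier G. t g h)"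
      unfolding DCE.graded_product_app[OF uv w k]
    proof (rule E.finsum_cong'[OF refl])
      fix g assume g: "g \<in> carrier G"
      show "\<gamma> g (graded_product G A B D \<beta> u v g) (inv g \<otimes> k) (w (inv g \<otimes> k)) =
          (\<Oplus>\<^bsub>E\<^esub>h\<in>carrier G. t g h)"
        unfolding ABD.graded_product_app[OF u v g] t_def
        by (rule additive_finsum[OF D.abelian_group_axioms E.abelian_group_axioms])
          (use g k app closed DCE.pair_add_left in auto)
    qed (use t in \<open>auto intro!: E.finsum_closed\<close>)
    also have "\<dots> = (\<Oplus>\<^bsub>E\<^esub>h\<in>carrier G. \<Oplus>\<^bsub>E\<^esub>g\<in>carrier G. t g h)"
      using fin t by (rule E.finsum_swap[OF fin])
    also have "\<dots> = (\<Oplus>\<^bsub>E\<^esub>h\<in>carrier G. \<gamma>' h (u h) (inv h \<otimes> k)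
        (graded_product G B C F \<beta>' v w (inv h \<otimes> k)))"
    proof (rule E.finsum_cong'[OF refl])
      fix h assume h: "h \<in> carrier G"
      let ?s = "\<lambda>l. \<beta>' l (v l) (inv l \<otimes> (inv h \<otimes> k)) (w (inv l \<otimes> (inv h \<otimes> k)))"
      have hk: "inv h \<otimes> k \<in> carrier G" using h k by simp
      \<comment> \<open>Left translation by \<open>h\<close> permutes \<open>G\<close>; after
        substituting \<open>h \<otimes> l\<close> for \<open>g\<close>, the variable
        \<open>l\<close> is the degree taken from \<open>v\<close>.\<close>
      have "(\<Oplus>\<^bsub>E\<^esub>g\<in>carrier G. t g h) = (\<Oplus>\<^bsub>E\<^esub>g\<in>(\<lambda>l. h \<otimes> l) ` carrier G. t g h)"
        using ABD.surj_const_mult[OF h] by simp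
      also have "\<dots> = (\<Oplus>\<^bsub>E\<^esub>l\<in>carrier G. t (h \<otimes> l) h)"
        by (rule E.finsum_reindex) (use h t ABD.inj_on_cmult in auto)
      also have "\<dots> = (\<Oplus>\<^bsub>E\<^esub>l\<in>carrier G. \<gamma>' h (u h) (inv h \<otimes> k) (?s l))"
      proof (rule E.finsum_cong'[OF refl])
        fix l assume l: "l \<in> carrier G"
        \<comment> \<open>The degrees of the three factors are now \<open>h\<close>,
          \<open>l\<close> and \<open>inv l \<otimes> (inv h \<otimes> k)\<close>; the last equation
          gives the degree of the product of the final two.\<close>
        have eqs: "inv h \<otimes> (h \<otimes> l) = l" "inv (h \<otimes> l) \<otimes> k = inv l \<otimes> (inv h \<otimes> k)"
          "l \<otimes> (inv l \<otimes> (inv h \<otimes> k)) = inv h \<otimes> k"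
          using h k l ABD.m_assoc[of "inv h" h l] ABD.m_assoc[of l "inv l" "inv h \<otimes> k"]
          by (simp_all add: ABD.inv_mult_group ABD.m_assoc[of "inv l"])
        show "t (h \<otimes> l) h = \<gamma>' h (u h) (inv h \<otimes> k) (?s l)"
          using assoc[of h l "inv l \<otimes> (inv h \<otimes> k)" "u h" "v l" "w (inv l \<otimes> (inv h \<otimes> k))"] h l k app
          by (simp add: t_def eqs)
      qed (use h k in \<open>auto intro!: closed app\<close>)
      also have "\<dots> = \<gamma>' h (u h) (inv h \<otimes> k) (\<Oplus>\<^bsub>F\<^esub>l\<in>carrier G. ?s l)"
        by (rule additive_finsum[OF F.abelian_group_axioms E.abelian_group_axioms, symmetric])
          (use h k app closed AFE.pair_add_right in auto)
      finally show "(\<Oplus>\<^bsub>E\<^esub>g\<in>carrier G. t g h) = \<gamma>' h (u h) (inv h \<otimes> k)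
          (graded_product G B C F \<beta>' v w (inv h \<otimes> k))"
        unfolding BCF.graded_product_app[OF v w hk] .
    qed (use k vw app in \<open>auto intro!: closed simp: ABD.formal_sums_app\<close>)
    also have "\<dots> = graded_product G A F E \<gamma>' u (graded_product G B C F \<beta>' v w) k"
      by (rule AFE.graded_product_app[OF u vw k, symmetric])
    finally show "graded_product G D C E \<gamma> (graded_product G A B D \<beta> u v) w k =
      graded_product G A F E \<gamma>' u (graded_product G B C F \<beta>' v w) k" .
  qed (rule AFE.graded_product_closed[OF u vw])
qed

section \<open>Tensor products of bimodules\<close>

locale tensor_pair = M: bimodule R M + N: bimodule R N for R (structure) and M and N
begin

abbreviation "F \<equiv> free_Abelian_group (carrier M \<times> carrier N)"
abbreviation "K \<equiv> tensor_kernel R M N"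

section \<open>The subgroup of tensor relations and its cosets\<close>

lemma relators_subset: "tensor_relators R M N \<subseteq> carrier F"
proof -
  have frag: "frag_of p \<in> carrier F" if "p \<in> carrier M \<times> carrier N" for p
    using that by simp
  have diff: "c - d \<in> carrier F" if "c \<in> carrier F" "d \<in> carrier F" for c d
    using that keys_diff[of c d] by fastforce
  show ?thesis
    unfolding tensor_relators_def
    by (auto simp del: carrier_free_Abelian_group_iff intro!: diff frag
        M.rsmult_closed N.lsmult_closed)
qed

lemma kernel_subgroup: "subgroup K F"
  unfolding tensor_kernel_def
  by (rule group.generate_is_subgroup[OF _ relators_subset]) simp

lemma kernel_normal: "K \<lhd> F"
  by (intro comm_group.subgroup_imp_normal kernel_subgroup abelian_free_Abelian_group)

lemma kernel_add: "c \<in> K \<Longrightarrow> d \<in> K \<Longrightarrow> c + d \<in> K"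
  using subgroup.m_closed[OF kernel_subgroup] by simp

lemma kernel_uminus: "c \<in> K \<Longrightarrow> - c \<in> K"
  using subgroup.m_inv_closed[OF kernel_subgroup] subgroup.mem_carrier[OF kernel_subgroup, of c]
  by force

lemma kernel_zero: "0 \<in> K"
  using subgroup.one_closed[OF kernel_subgroup] by simp

lemma kernel_relators:
  "\<lbrakk>x \<in> carrier M; x' \<in> carrier M; y \<in> carrier N\<rbrakk> \<Longrightarrow>
    frag_of (x \<oplus>\<^bsub>M\<^esub> x', y) - frag_of (x, y) - frag_of (x', y) \<in> K"
  "\<lbrakk>x \<in> carrier M; y \<in> carrier N; y' \<in> carrier N\<rbrakk> \<Longrightarrow>
    frag_of (x, y \<oplus>\<^bsub>N\<^esub> y') - frag_of (x, y) - frag_of (x, y') \<in> K"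
  "\<lbrakk>x \<in> carrier M; a \<in> carrier R; y \<in> carrier N\<rbrakk> \<Longrightarrow>
    frag_of (x \<triangleleft>\<^bsub>M\<^esub> a, y) - frag_of (x, a \<odot>\<^bsub>N\<^esub> y) \<in> K"
  unfolding tensor_kernel_def by (rule generate.incl; auto simp: tensor_relators_def)+

lemma tensor_class_alt: "tensor_class R M N c = (\<lambda>k. k + c) ` K"
  by (auto simp: tensor_class_def r_coset_def)

lemma tensor_class_eqI:
  assumes "c - d \<in> K"
  shows "tensor_class R M N c = tensor_class R M N d"
proof -
  have "k + c = (k + (c - d)) + d" "k + d = (k + - (c - d)) + c" for k
    by simp_all
  thus ?thesis
    unfolding tensor_class_alt using assms kernel_add kernel_uminus by (blast intro: image_eqI)
qed

lemma tensor_class_add: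
  assumes "c \<in> carrier F" "d \<in> carrier F"
  shows "tensor_class R M N c \<oplus>\<^bsub>tensor_product R M N\<^esub> tensor_class R M N d =
    tensor_class R M N (c + d)"
  using normal.rcos_sum[OF kernel_normal assms]
  by (simp add: tensor_product_def Let_def tensor_class_def)

section \<open>Laws for pure tensors and the outer actions\<close>

lemma tensor_closed:
  assumes "x \<in> carrier M" "y \<in> carrier N"
  shows "tensor R M N x y \<in> carrier (tensor_product R M N)"
  using assms
  by (auto simp: tensor_product_def Let_def tensor_def tensor_class_def carrier_FactGroup)

lemma tensor_add_left:
  assumes "x \<in> carrier M" "x' \<in> carrier M" "y \<in> carrier N"
  shows "tensor R M N (x \<oplus>\<^bsub>M\<^esub> x') y =
    tensor R M N x y \<oplus>\<^bsub>tensor_product R M N\<^esub> tensor R M N x' y"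
  unfolding tensor_def using assms kernel_relators(1)[OF assms]
  by (subst tensor_class_add) (auto intro!: tensor_class_eqI simp: diff_diff_eq)

lemma tensor_add_right:
  assumes "x \<in> carrier M" "y \<in> carrier N" "y' \<in> carrier N"
  shows "tensor R M N x (y \<oplus>\<^bsub>N\<^esub> y') =
    tensor R M N x y \<oplus>\<^bsub>tensor_product R M N\<^esub> tensor R M N x y'"
  unfolding tensor_def using assms kernel_relators(2)[OF assms]
  by (subst tensor_class_add) (auto intro!: tensor_class_eqI simp: diff_diff_eq)

lemma tensor_balanced:
  assumes "x \<in> carrier M" "a \<in> carrier R" "y \<in> carrier N"
  shows "tensor R M N (x \<triangleleft>\<^bsub>M\<^esub> a) y = tensor R M N x (a \<odot>\<^bsub>N\<^esub> y)"
  unfolding tensor_def by (intro tensor_class_eqI kernel_relators assms)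

text \<open>The kernel is generated by the relators and \<open>frag_extend f\<close> is additive, so
  it is enough to control the images of the relators. This makes the outer actions on the tensor
  product well defined.\<close>

lemma frag_extend_kernel:
  assumes add_left: "\<And>x x' y. \<lbrakk>x \<in> carrier M; x' \<in> carrier M; y \<in> carrier N\<rbrakk> \<Longrightarrow>
      f (x \<oplus>\<^bsub>M\<^esub> x', y) - f (x, y) - f (x', y) \<in> K"
    and add_right: "\<And>x y y'. \<lbrakk>x \<in> carrier M; y \<in> carrier N; y' \<in> carrier N\<rbrakk> \<Longrightarrow>
      f (x, y \<oplus>\<^bsub>N\<^esub> y') - f (x, y) - f (x, y') \<in> K"
    and balanced: "\<And>x a y. \<lbrakk>x \<in> carrier M; a \<in> carrier R; y \<in> carrier N\<rbrakk> \<Longrightarrow>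
      f (x \<triangleleft>\<^bsub>M\<^esub> a, y) - f (x, a \<odot>\<^bsub>N\<^esub> y) \<in> K"
    and "c \<in> K"
  shows "frag_extend f c \<in> K"
proof -
  have rel: "frag_extend f c \<in> K" if "c \<in> tensor_relators R M N" for c
    using that assms(1-3) unfolding tensor_relators_def by (auto simp: frag_extend_diff)
  show ?thesis
    using assms(4) unfolding tensor_kernel_def
  proof (induction rule: generate.induct)
    case one
    then show ?case using kernel_zero by (simp add: tensor_kernel_def)
  next
    case (incl h)
    then show ?case using rel by (simp add: tensor_kernel_def)
  next
    case (inv h)
    \<comment> \<open>Group inverse and negation are identified for elements of the carrier, whence
      the appeal to \<open>relators_subset\<close>.\<close>
    then have "inv\<^bsub>F\<^esub> h = - h" using relators_subset by force
    then show ?case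
      using rel[OF inv] kernel_uminus by (simp add: frag_extend_minus tensor_kernel_def)
  next
    case (eng h1 h2)
    then show ?case using kernel_add by (simp add: frag_extend_add tensor_kernel_def)
  qed
qed

text \<open>Representatives of a coset differ by kernel elements, whose images stay in the kernel.
  All cosets in the union therefore coincide, and the union is a single coset.\<close>

lemma Union_tensor_class_frag_extend:
  assumes "\<And>c. c \<in> K \<Longrightarrow> frag_extend f c \<in> K"
  shows "(\<Union>c\<in>tensor R M N x y. tensor_class R M N (frag_extend f c)) =
    tensor_class R M N (f (x, y))"
proof -
  have "tensor_class R M N (frag_extend f (k + frag_of (x, y))) = tensor_class R M N (f (x, y))"
    if "k \<in> K" for k
    by (rule tensor_class_eqI) (use assms[OF that] in \<open>simp add: frag_extend_add\<close>)
  thus ?thesis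
    unfolding tensor_def tensor_class_alt[of "frag_of (x, y)"] using kernel_zero by auto
qed

lemma smult_tensor:
  assumes "a \<in> carrier R"
  shows "a \<odot>\<^bsub>tensor_product R M N\<^esub> tensor R M N x y = tensor R M N (a \<odot>\<^bsub>M\<^esub> x) y"
proof -
  \<comment> \<open>Balancing relators go to balancing relators because the left and right actions
    on \<open>M\<close> commute.\<close>
  have "frag_extend (\<lambda>(x, y). frag_of (a \<odot>\<^bsub>M\<^esub> x, y)) c \<in> K" if "c \<in> K" for c
    using assms
    by (intro frag_extend_kernel that)
      (simp_all add: M.lsmult_r_distr M.lsmult_rsmult[symmetric] kernel_relators M.lsmult_closed)
  from Union_tensor_class_frag_extend[OF this] show ?thesis
    by (simp add: tensor_product_def Let_def tensor_def)
qed

lemma tensor_rsmult: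
  assumes "a \<in> carrier R"
  shows "tensor R M N x y \<triangleleft>\<^bsub>tensor_product R M N\<^esub> a = tensor R M N x (y \<triangleleft>\<^bsub>N\<^esub> a)"
proof -
  have "frag_extend (\<lambda>(x, y). frag_of (x, y \<triangleleft>\<^bsub>N\<^esub> a)) c \<in> K" if "c \<in> K" for c
    using assms
    by (intro frag_extend_kernel that)
      (simp_all add: N.rsmult_l_distr N.lsmult_rsmult kernel_relators N.rsmult_closed)
  from Union_tensor_class_frag_extend[OF this] show ?thesis
    by (simp add: tensor_product_def Let_def tensor_def)
qed

end

section \<open>Theta-extensions\<close>

context theta_datum
begin

interpretation tensor_pair R M M ..

text \<open>On pure tensors \<theta> is an ordinary binary operation on \<open>M\<close>; all later
  computations use only its laws and never the quotient construction.\<close>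

abbreviation theta_mult (infixl "\<diamondop>" 70) where "x \<diamondop> y \<equiv> \<theta> (tensor R M M x y)"

section \<open>Laws of \<theta> as a binary operation\<close>

lemma theta_closed: "x \<in> carrier M \<Longrightarrow> y \<in> carrier M \<Longrightarrow> x \<diamondop> y \<in> carrier M"
  using theta_hom tensor_closed by (auto simp: bimodule_hom_def hom_def)

lemma theta_add:
  "X \<in> carrier (tensor_product R M M) \<Longrightarrow> Y \<in> carrier (tensor_product R M M) \<Longrightarrow>
    \<theta> (X \<oplus>\<^bsub>tensor_product R M M\<^esub> Y) = \<theta> X \<oplus>\<^bsub>M\<^esub> \<theta> Y"
  using theta_hom by (auto simp: bimodule_hom_def hom_def)

lemma theta_add_left:
  "\<lbrakk>x \<in> carrier M; x' \<in> carrier M; y \<in> carrier M\<rbrakk> \<Longrightarrow>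
    (x \<oplus>\<^bsub>M\<^esub> x') \<diamondop> y = x \<diamondop> y \<oplus>\<^bsub>M\<^esub> x' \<diamondop> y"
  by (simp add: tensor_add_left theta_add tensor_closed)

lemma theta_add_right:
  "\<lbrakk>x \<in> carrier M; y \<in> carrier M; y' \<in> carrier M\<rbrakk> \<Longrightarrow>
    x \<diamondop> (y \<oplus>\<^bsub>M\<^esub> y') = x \<diamondop> y \<oplus>\<^bsub>M\<^esub> x \<diamondop> y'"
  by (simp add: tensor_add_right theta_add tensor_closed)

lemma theta_balanced:
  "\<lbrakk>x \<in> carrier M; a \<in> carrier R; y \<in> carrier M\<rbrakk> \<Longrightarrow> (x \<triangleleft>\<^bsub>M\<^esub> a) \<diamondop> y = x \<diamondop> (a \<odot>\<^bsub>M\<^esub> y)"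
  by (simp add: tensor_balanced)

lemma theta_smult:
  assumes "a \<in> carrier R" "x \<in> carrier M" "y \<in> carrier M"
  shows "(a \<odot>\<^bsub>M\<^esub> x) \<diamondop> y = a \<odot>\<^bsub>M\<^esub> (x \<diamondop> y)"
  using theta_hom assms tensor_closed[OF assms(2,3)]
  by (simp add: bimodule_hom_def flip: smult_tensor)

lemma theta_rsmult:
  assumes "a \<in> carrier R" "x \<in> carrier M" "y \<in> carrier M"
  shows "x \<diamondop> (y \<triangleleft>\<^bsub>M\<^esub> a) = (x \<diamondop> y) \<triangleleft>\<^bsub>M\<^esub> a"
  using theta_hom assms tensor_closed[OF assms(2,3)]
  by (simp add: bimodule_hom_def flip: tensor_rsmult)

lemma lsmult_zero: "a \<in> carrier R \<Longrightarrow> a \<odot>\<^bsub>M\<^esub> \<zero>\<^bsub>M\<^esub> = \<zero>\<^bsub>M\<^esub>"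
  using additive_finsum[OF M.abelian_group_axioms M.abelian_group_axioms,
      of "\<lambda>x. a \<odot>\<^bsub>M\<^esub> x" "{}" undefined]
  by (simp add: lsmult_closed lsmult_r_distr)

lemma rsmult_zero: "a \<in> carrier R \<Longrightarrow> \<zero>\<^bsub>M\<^esub> \<triangleleft>\<^bsub>M\<^esub> a = \<zero>\<^bsub>M\<^esub>"
  using additive_finsum[OF M.abelian_group_axioms M.abelian_group_axioms,
      of "\<lambda>x. x \<triangleleft>\<^bsub>M\<^esub> a" "{}" undefined]
  by (simp add: rsmult_closed rsmult_l_distr)

lemma theta_zero_left: "x \<in> carrier M \<Longrightarrow> \<zero>\<^bsub>M\<^esub> \<diamondop> x = \<zero>\<^bsub>M\<^esub>"
  using additive_finsum[OF M.abelian_group_axioms M.abelian_group_axioms,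
      of "\<lambda>y. y \<diamondop> x" "{}" undefined]
  by (simp add: theta_closed theta_add_left)

lemma theta_zero_right: "x \<in> carrier M \<Longrightarrow> x \<diamondop> \<zero>\<^bsub>M\<^esub> = \<zero>\<^bsub>M\<^esub>"
  using additive_finsum[OF M.abelian_group_axioms M.abelian_group_axioms,
      of "\<lambda>y. x \<diamondop> y" "{}" undefined]
  by (simp add: theta_closed theta_add_right)

lemmas bimodule_closed = lsmult_closed rsmult_closed theta_closed
lemmas bimodule_distr = lsmult_l_distr lsmult_r_distr rsmult_r_distr rsmult_l_distr
  theta_add_left theta_add_right

section \<open>Ring axioms for \<theta>-extensions\<close>

lemma abelian_group_theta_extension: "abelian_group (theta_extension R M \<theta>)"
proof (rule abelian_groupI)
  fix u assume "u \<in> carrier (theta_extension R M \<theta>)"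
  thus "\<exists>v\<in>carrier (theta_extension R M \<theta>). v \<oplus>\<^bsub>theta_extension R M \<theta>\<^esub> u = \<zero>\<^bsub>theta_extension R M \<theta>\<^esub>"
    by (intro bexI[of _ "(\<ominus>\<^bsub>R\<^esub> fst u, \<ominus>\<^bsub>M\<^esub> snd u)"])
      (auto simp: theta_extension_def R.l_neg M.l_neg)
qed (auto simp: theta_extension_def R.a_ac M.a_ac)

text \<open>In a triple product the module component has seven terms for either bracketing. They
  match one by one through the bimodule laws, bilinearity and balancedness of \<theta>, and its
  associativity.\<close>

lemma ring_theta_extension: "ring (theta_extension R M \<theta>)"
proof (rule ringI[OF abelian_group_theta_extension])
  show "monoid (theta_extension R M \<theta>)"
    by (rule monoidI)
      (auto simp: theta_extension_def bimodule_closed bimodule_distr lsmult_one rsmult_one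
        lsmult_zero rsmult_zero theta_zero_left theta_zero_right R.m_assoc M.a_ac
        lsmult_assoc rsmult_assoc lsmult_rsmult theta_balanced theta_smult theta_rsmult theta_assoc)
qed (auto simp: theta_extension_def bimodule_closed bimodule_distr R.l_distr R.r_distr M.a_ac)

end

section \<open>Skew group rings\<close>

context group_action
begin

lemma action_closed: "g \<in> carrier G \<Longrightarrow> x \<in> E \<Longrightarrow> \<phi> g x \<in> E"
  using element_image by blast

lemma action_one: "x \<in> E \<Longrightarrow> \<phi> \<one> x = x"
  by (simp flip: id_eq_one)

end

locale finite_ring_action = ring_action +
  assumes finite_group: "finite (carrier G)"
begin

lemma ring_action_facts:
  assumes "g \<in> carrier G"
  shows action_one_ring: "\<phi> g \<one>\<^bsub>R\<^esub> = \<one>\<^bsub>R\<^esub>"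
    and action_add: "\<And>a b. \<lbrakk>a \<in> carrier R; b \<in> carrier R\<rbrakk> \<Longrightarrow> \<phi> g (a \<oplus>\<^bsub>R\<^esub> b) = \<phi> g a \<oplus>\<^bsub>R\<^esub> \<phi> g b"
    and action_mult: "\<And>a b. \<lbrakk>a \<in> carrier R; b \<in> carrier R\<rbrakk> \<Longrightarrow> \<phi> g (a \<otimes>\<^bsub>R\<^esub> b) = \<phi> g a \<otimes>\<^bsub>R\<^esub> \<phi> g b"
  using ring_iso_memE[OF action_ring_iso[OF assms]] by auto

lemma group_G: "group G"
  using group_hom by (rule group_hom.axioms)

lemma ring_pairing: "graded_pairing G R R R (\<lambda>g a h b. a \<otimes>\<^bsub>R\<^esub> \<phi> g b)"
  by (intro graded_pairing.intro graded_pairing_axioms.intro group_G R.abelian_group_axioms)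
    (auto simp: finite_group action_closed action_add R.l_distr R.r_distr)

text \<open>The left unit law holds because the group identity acts trivially, the right one because
  automorphisms fix the ring unit.\<close>

lemma ring_skew_group_ring: "ring (skew_group_ring R G \<phi>)"
proof -
  interpret P: graded_pairing G R R R "\<lambda>g a h b. a \<otimes>\<^bsub>R\<^esub> \<phi> g b" by (rule ring_pairing)
  let ?S = "skew_group_ring R G \<phi>"
  have ab: "abelian_group ?S"
    by (rule abelian_group_formal_sums[OF R.abelian_group_axioms finite_group])
      (simp_all add: skew_group_ring_def)
  have assoc: "graded_product G R R R (\<lambda>g a h b. a \<otimes>\<^bsub>R\<^esub> \<phi> g b)
        (graded_product G R R R (\<lambda>g a h b. a \<otimes>\<^bsub>R\<^esub> \<phi> g b) u v) w =
      graded_product G R R R (\<lambda>g a h b. a \<otimes>\<^bsub>R\<^esub> \<phi> g b) u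
        (graded_product G R R R (\<lambda>g a h b. a \<otimes>\<^bsub>R\<^esub> \<phi> g b) v w)"
    if "u \<in> formal_sums G R" "v \<in> formal_sums G R" "w \<in> formal_sums G R" for u v w
    \<comment> \<open>The homogeneous identity is
      \<open>(a g(b)) (gh)(c) = a g(b h(c))\<close>.\<close>
    by (rule graded_product_assoc[OF ring_pairing ring_pairing ring_pairing ring_pairing _ that])
      (simp add: action_mult action_closed R.m_assoc composition_rule)
  have mono: "monomial G R \<one>\<^bsub>R\<^esub> \<one> \<in> formal_sums G R"
    by (auto simp: formal_sums_finite finite_group monomial_def)
  show ?thesis
  proof (rule ringI[OF ab])
    show "monoid ?S"
      by (rule monoidI)
        (auto simp: skew_group_ring_def P.graded_product_closed assoc mono action_one action_one_ring
          intro!: graded_product_unit_left graded_product_unit_right ring_pairing)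
  qed (auto simp: skew_group_ring_def P.graded_product_add_left P.graded_product_add_right)
qed

end

section \<open>Induced bimodules\<close>

locale finite_equivariant_theta_datum = equivariant_theta_datum +
  assumes finite_group: "finite (carrier G)"
begin

sublocale R_act: finite_ring_action G R \<phi>
  by unfold_locales (rule finite_group)

text \<open>Equivariance is given for two-sided products; the right scalar is set to the unit, which
  the action fixes.\<close>

lemma M_act_lsmult:
  assumes "g \<in> carrier G" "a \<in> carrier R" "x \<in> carrier M"
  shows "\<psi> g (a \<odot>\<^bsub>M\<^esub> x) = \<phi> g a \<odot>\<^bsub>M\<^esub> \<psi> g x"
  using M_act_smult[of g a x "\<one>\<^bsub>R\<^esub>"] assms
  by (simp add: rsmult_one lsmult_closed R_act.action_one_ring R_act.action_closed M_act.action_closed)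

lemma M_act_rsmult:
  assumes "g \<in> carrier G" "a \<in> carrier R" "x \<in> carrier M"
  shows "\<psi> g (x \<triangleleft>\<^bsub>M\<^esub> a) = \<psi> g x \<triangleleft>\<^bsub>M\<^esub> \<phi> g a"
  using M_act_smult[of g "\<one>\<^bsub>R\<^esub>" x a] assms
  by (simp add: lsmult_one R_act.action_one_ring M_act.action_closed)

lemmas act_closed = R_act.action_closed M_act.action_closed
lemmas act_simps = R_act.action_add R_act.action_mult R_act.action_one_ring R_act.action_one
  R_act.composition_rule M_act_add M_act.action_one M_act.composition_rule M_act_lsmult M_act_rsmult
  M_act_theta

abbreviation "ring_mult \<equiv> (\<lambda>g a h b. a \<otimes>\<^bsub>R\<^esub> \<phi> g b)"
abbreviation "left_mult \<equiv> (\<lambda>g a h x. a \<odot>\<^bsub>M\<^esub> \<psi> g x)"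
abbreviation "right_mult \<equiv> (\<lambda>h x g b. x \<triangleleft>\<^bsub>M\<^esub> \<phi> h b)"
abbreviation "theta_pair \<equiv> (\<lambda>g x h y. x \<diamondop> \<psi> g y)"

section \<open>Homogeneous pairings for the induced structures\<close>

lemma left_pairing: "graded_pairing G R M M left_mult"
  by (intro graded_pairing.intro graded_pairing_axioms.intro R_act.group_G
      R.abelian_group_axioms M.abelian_group_axioms)
    (auto simp: finite_group bimodule_closed bimodule_distr act_closed act_simps)

lemma right_pairing: "graded_pairing G M R M right_mult"
  by (intro graded_pairing.intro graded_pairing_axioms.intro R_act.group_G
      R.abelian_group_axioms M.abelian_group_axioms)
    (auto simp: finite_group bimodule_closed bimodule_distr act_closed act_simps)

lemma theta_pairing: "graded_pairing G M M M theta_pair"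
  by (intro graded_pairing.intro graded_pairing_axioms.intro R_act.group_G
      R.abelian_group_axioms M.abelian_group_axioms)
    (auto simp: finite_group bimodule_closed bimodule_distr act_closed act_simps)

sublocale L: graded_pairing G R M M left_mult by (rule left_pairing)
sublocale Rt: graded_pairing G M R M right_mult by (rule right_pairing)
sublocale T: graded_pairing G M M M theta_pair by (rule theta_pairing)
sublocale P: graded_pairing G R R R ring_mult by (rule R_act.ring_pairing)

abbreviation "RG \<equiv> skew_group_ring R G \<phi>"
abbreviation "MG \<equiv> induced_bimodule R M G \<phi> \<psi>"

lemma abelian_group_induced: "abelian_group MG"
  by (rule abelian_group_formal_sums[OF M.abelian_group_axioms finite_group])
    (simp_all add: induced_bimodule_def)

text \<open>Each of the three associativity laws is an instance of
  \<open>graded_product_assoc\<close>; equivariance of the actions supplies the homogeneous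
  identities.\<close>

lemma bimodule_induced: "bimodule RG MG"
proof (intro bimodule.intro bimodule_axioms.intro R_act.ring_skew_group_ring abelian_group_induced)
  fix u v w
  assume "u \<in> carrier RG" "v \<in> carrier RG" "w \<in> carrier MG"
  hence uvw: "u \<in> formal_sums G R" "v \<in> formal_sums G R" "w \<in> formal_sums G M"
    by (simp_all add: skew_group_ring_def induced_bimodule_def)
  show "(u \<otimes>\<^bsub>RG\<^esub> v) \<odot>\<^bsub>MG\<^esub> w = u \<odot>\<^bsub>MG\<^esub> (v \<odot>\<^bsub>MG\<^esub> w)"
    unfolding skew_group_ring_def induced_bimodule_def bimodule.simps module.simps ring.simps monoid.simps
    by (rule graded_product_assoc[OF R_act.ring_pairing left_pairing left_pairing left_pairing _ uvw])
      (simp add: act_simps act_closed lsmult_assoc bimodule_closed)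
  show "w \<triangleleft>\<^bsub>MG\<^esub> (u \<otimes>\<^bsub>RG\<^esub> v) = w \<triangleleft>\<^bsub>MG\<^esub> u \<triangleleft>\<^bsub>MG\<^esub> v"
    unfolding skew_group_ring_def induced_bimodule_def bimodule.simps module.simps ring.simps monoid.simps
    \<comment> \<open>The factors occur in the order \<open>w\<close>, \<open>u\<close>,
      \<open>v\<close>, and this law is oriented from right to left bracketing reversed, hence
      \<open>symmetric\<close>.\<close>
    by (rule graded_product_assoc[OF right_pairing right_pairing R_act.ring_pairing right_pairing _ uvw(3,1,2), symmetric])
      (simp add: act_simps act_closed rsmult_assoc bimodule_closed)
  show "u \<odot>\<^bsub>MG\<^esub> w \<triangleleft>\<^bsub>MG\<^esub> v = u \<odot>\<^bsub>MG\<^esub> (w \<triangleleft>\<^bsub>MG\<^esub> v)"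
    unfolding skew_group_ring_def induced_bimodule_def bimodule.simps module.simps ring.simps monoid.simps
    by (rule graded_product_assoc[OF left_pairing right_pairing right_pairing left_pairing _ uvw(1,3,2)])
      (simp add: act_simps act_closed lsmult_rsmult bimodule_closed)
qed (auto simp: skew_group_ring_def induced_bimodule_def L.graded_product_closed Rt.graded_product_closed
    L.graded_product_add_left L.graded_product_add_right Rt.graded_product_add_left
    Rt.graded_product_add_right lsmult_one rsmult_one act_simps act_closed
    intro!: graded_product_unit_left graded_product_unit_right left_pairing right_pairing)

text \<open>The lift may be evaluated on pure tensors once the pairing is known to be biadditive and
  balanced. Balancedness is again associativity of graded products, from the homogeneous identity
  \<open>(x g(b)) \<diamondop> (gh)(y) = x \<diamondop> g(b h(y))\<close>.\<close>

lemma induced_theta_tensor: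
  assumes "u \<in> formal_sums G M" "v \<in> formal_sums G M"
  shows "induced_theta R M G \<phi> \<psi> \<theta> (tensor RG MG MG u v) = graded_product G M M M theta_pair u v"
  unfolding induced_theta_def
proof (rule tensor_lift_tensor[OF abelian_group_induced bimodule_induced bimodule_induced])
  fix u v w
  assume "u \<in> carrier MG" "v \<in> carrier RG" "w \<in> carrier MG"
  hence uvw: "u \<in> formal_sums G M" "v \<in> formal_sums G R" "w \<in> formal_sums G M"
    by (simp_all add: skew_group_ring_def induced_bimodule_def)
  show "graded_product G M M M theta_pair (u \<triangleleft>\<^bsub>MG\<^esub> v) w =
      graded_product G M M M theta_pair u (v \<odot>\<^bsub>MG\<^esub> w)"
    unfolding skew_group_ring_def induced_bimodule_def bimodule.simps module.simps ring.simps monoid.simps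
    by (rule graded_product_assoc[OF right_pairing theta_pairing left_pairing theta_pairing _ uvw])
      (simp add: act_simps act_closed theta_balanced bimodule_closed)
qed (use assms in \<open>auto simp: induced_bimodule_def T.graded_product_closed
    T.graded_product_add_left T.graded_product_add_right\<close>)

end

section \<open>The isomorphism\<close>

context finite_equivariant_theta_datum
begin

abbreviation "\<Lambda> \<equiv> theta_extension R M \<theta>"
abbreviation "\<alpha> \<equiv> extension_action R M \<phi> \<psi>"

text \<open>The action is componentwise; equivariance of both module actions and of \<theta> makes
  it multiplicative.\<close>

lemma ring_action_extension: "ring_action G \<Lambda> \<alpha>"
proof -
  have E: "carrier \<Lambda> = carrier R \<times> carrier M" by (simp add: theta_extension_def)
  have app: "\<alpha> g (a, x) = (\<phi> g a, \<psi> g x)" if "a \<in> carrier R" "x \<in> carrier M" for g a x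
    using that by (simp add: extension_action_def)
  have bij: "bij_betw (\<alpha> g) (carrier \<Lambda>) (carrier \<Lambda>)" if g: "g \<in> carrier G" for g
  proof (rule bij_betw_byWitness[where f' = "\<alpha> (inv g)"])
    show "\<forall>p\<in>carrier \<Lambda>. \<alpha> (inv g) (\<alpha> g p) = p" "\<forall>p\<in>carrier \<Lambda>. \<alpha> g (\<alpha> (inv g) p) = p"
      \<comment> \<open>The composition rules are reversed so that \<open>g\<close> and
        \<open>inv g\<close> merge into the identity of \<open>G\<close>.\<close>
      using g by (auto simp: E app act_closed act_simps simp flip: R_act.composition_rule M_act.composition_rule)
  qed (use g in \<open>auto simp: E app act_closed\<close>)
  have Bij: "\<alpha> g \<in> Bij (carrier \<Lambda>)" if "g \<in> carrier G" for g
    using bij[OF that] by (auto simp: Bij_def E extension_action_def)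
  show ?thesis
  proof (intro ring_action.intro group_action.intro ring_theta_extension ring_action_axioms.intro
      group_hom.intro group_hom_axioms.intro R_act.group_G group_BijGroup homI)
    fix g h assume gh: "g \<in> carrier G" "h \<in> carrier G"
    have "\<alpha> (g \<otimes> h) = compose (carrier \<Lambda>) (\<alpha> g) (\<alpha> h)"
    proof
      fix p show "\<alpha> (g \<otimes> h) p = compose (carrier \<Lambda>) (\<alpha> g) (\<alpha> h) p"
        using gh by (auto simp: compose_def E extension_action_def act_closed act_simps)
    qed
    thus "\<alpha> (g \<otimes> h) = \<alpha> g \<otimes>\<^bsub>BijGroup (carrier \<Lambda>)\<^esub> \<alpha> h"
      using gh Bij by (simp add: BijGroup_def)
  next
    fix g assume g: "g \<in> carrier G"
    thus "\<alpha> g \<in> carrier (BijGroup (carrier \<Lambda>))" using Bij by (simp add: BijGroup_def)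
    \<comment> \<open>Needed for the unit of \<Lambda>, whose module component is zero.\<close>
    have "\<psi> g \<zero>\<^bsub>M\<^esub> = \<zero>\<^bsub>M\<^esub>"
      using additive_finsum[OF M.abelian_group_axioms M.abelian_group_axioms, of "\<psi> g" "{}" undefined] g
      by (simp add: act_simps act_closed)
    thus "\<alpha> g \<in> ring_iso \<Lambda> \<Lambda>"
      unfolding ring_iso_def using g bij
      by (auto simp: theta_extension_def app act_closed act_simps bimodule_closed intro!: ring_hom_memI)
  qed
qed

sublocale \<Lambda>_act: finite_ring_action G \<Lambda> \<alpha>
  by (intro finite_ring_action.intro ring_action_extension finite_ring_action_axioms.intro finite_group)

abbreviation "\<Lambda>G \<equiv> skew_group_ring \<Lambda> G \<alpha>"
abbreviation "E \<equiv> theta_extension RG MG (induced_theta R M G \<phi> \<psi> \<theta>)"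

section \<open>The splitting map and its properties\<close>

definition split_coeffs where
  "split_coeffs u = (\<lambda>g\<in>carrier G. fst (u g), \<lambda>g\<in>carrier G. snd (u g))"

lemma extension_simps:
  "carrier \<Lambda> = carrier R \<times> carrier M"
  "p \<oplus>\<^bsub>\<Lambda>\<^esub> q = (fst p \<oplus>\<^bsub>R\<^esub> fst q, snd p \<oplus>\<^bsub>M\<^esub> snd q)"
  "\<one>\<^bsub>\<Lambda>\<^esub> = (\<one>\<^bsub>R\<^esub>, \<zero>\<^bsub>M\<^esub>)" "\<zero>\<^bsub>\<Lambda>\<^esub> = (\<zero>\<^bsub>R\<^esub>, \<zero>\<^bsub>M\<^esub>)"
  by (simp_all add: theta_extension_def case_prod_unfold)

lemma E_simps:
  "carrier E = formal_sums G R \<times> formal_sums G M"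
  "(u, v) \<oplus>\<^bsub>E\<^esub> (u', v') =
    (\<lambda>g\<in>carrier G. u g \<oplus>\<^bsub>R\<^esub> u' g, \<lambda>g\<in>carrier G. v g \<oplus>\<^bsub>M\<^esub> v' g)"
  "\<one>\<^bsub>E\<^esub> = (monomial G R \<one>\<^bsub>R\<^esub> \<one>, \<lambda>g\<in>carrier G. \<zero>\<^bsub>M\<^esub>)"
  "\<zero>\<^bsub>E\<^esub> = (\<lambda>g\<in>carrier G. \<zero>\<^bsub>R\<^esub>, \<lambda>g\<in>carrier G. \<zero>\<^bsub>M\<^esub>)"
  by (simp_all add: theta_extension_def skew_group_ring_def induced_bimodule_def)

text \<open>\<open>fst\<close> and \<open>snd\<close> are additive, so they pass under the
  convolution sum, where the product formula of \<Lambda> splits each summand.\<close>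

lemma split_coeffs_mult:
  assumes "u \<in> carrier \<Lambda>G" "w \<in> carrier \<Lambda>G"
  shows "split_coeffs (u \<otimes>\<^bsub>\<Lambda>G\<^esub> w) = split_coeffs u \<otimes>\<^bsub>E\<^esub> split_coeffs w"
proof -
  interpret Q: graded_pairing G \<Lambda> \<Lambda> \<Lambda> "\<lambda>g p h q. p \<otimes>\<^bsub>\<Lambda>\<^esub> \<alpha> g q"
    by (rule \<Lambda>_act.ring_pairing)
  have uw: "u \<in> formal_sums G \<Lambda>" "w \<in> formal_sums G \<Lambda>"
    using assms by (simp_all add: skew_group_ring_def)
  define a x b y where "a = (\<lambda>g\<in>carrier G. fst (u g))" and "x = (\<lambda>g\<in>carrier G. snd (u g))"
    and "b = (\<lambda>g\<in>carrier G. fst (w g))" and "y = (\<lambda>g\<in>carrier G. snd (w g))"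
  have app: "fst (u g) \<in> carrier R" "snd (u g) \<in> carrier M" "fst (w g) \<in> carrier R"
    "snd (w g) \<in> carrier M" if "g \<in> carrier G" for g
    using uw[THEN Q.formal_sums_app, OF that] by (auto simp: extension_simps)
  have fs: "a \<in> formal_sums G R" "b \<in> formal_sums G R" "x \<in> formal_sums G M" "y \<in> formal_sums G M"
    using app by (simp_all add: a_def b_def x_def y_def formal_sums_finite[OF finite_group])
  have prod: "u g \<otimes>\<^bsub>\<Lambda>\<^esub> \<alpha> g (w h) = (ring_mult g (a g) h (b h),
      left_mult g (a g) h (y h) \<oplus>\<^bsub>M\<^esub> right_mult g (x g) h (b h) \<oplus>\<^bsub>M\<^esub> theta_pair g (x g) h (y h))"
    if "g \<in> carrier G" "h \<in> carrier G" for g h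
    using that app
    by (simp add: theta_extension_def extension_action_def case_prod_unfold a_def b_def x_def y_def mem_Times_iff)
  have closed: "a g \<in> carrier R" "b g \<in> carrier R" "x g \<in> carrier M" "y g \<in> carrier M"
    if "g \<in> carrier G" for g
    using that app by (simp_all add: a_def b_def x_def y_def)
  have prod_closed: "u g \<otimes>\<^bsub>\<Lambda>\<^esub> \<alpha> g (w h) \<in> carrier R \<times> carrier M"
    if "g \<in> carrier G" "h \<in> carrier G" for g h
    using Q.pair_closed[of g h "u g" "w h"] that uw[THEN Q.formal_sums_app]
    by (simp add: extension_simps)
  let ?m = "graded_product G \<Lambda> \<Lambda> \<Lambda> (\<lambda>g p h q. p \<otimes>\<^bsub>\<Lambda>\<^esub> \<alpha> g q) u w"
  have fst_m: "fst (?m k) = graded_product G R R R ring_mult a b k" if k: "k \<in> carrier G" for k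
  proof -
    have "fst (?m k) = (\<Oplus>\<^bsub>R\<^esub>g\<in>carrier G. fst (u g \<otimes>\<^bsub>\<Lambda>\<^esub> \<alpha> g (w (inv\<^bsub>G\<^esub> g \<otimes>\<^bsub>G\<^esub> k))))"
      unfolding Q.graded_product_app[OF uw k]
      by (rule additive_finsum[OF abelian_group_theta_extension R.abelian_group_axioms])
        (use k prod_closed in \<open>auto simp: extension_simps\<close>)
    also have "\<dots> = graded_product G R R R ring_mult a b k"
      unfolding P.graded_product_app[OF fs(1,2) k]
      by (rule R.finsum_cong') (use k closed in \<open>auto simp: prod act_closed\<close>)
    finally show ?thesis .
  qed
  have snd_m: "snd (?m k) = graded_product G R M M left_mult a y k
      \<oplus>\<^bsub>M\<^esub> graded_product G M R M right_mult x b k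
      \<oplus>\<^bsub>M\<^esub> graded_product G M M M theta_pair x y k" if k: "k \<in> carrier G" for k
  proof -
    have "snd (?m k) = (\<Oplus>\<^bsub>M\<^esub>g\<in>carrier G. snd (u g \<otimes>\<^bsub>\<Lambda>\<^esub> \<alpha> g (w (inv\<^bsub>G\<^esub> g \<otimes>\<^bsub>G\<^esub> k))))"
      unfolding Q.graded_product_app[OF uw k]
      by (rule additive_finsum[OF abelian_group_theta_extension M.abelian_group_axioms])
        (use k prod_closed in \<open>auto simp: extension_simps\<close>)
    also have "\<dots> = (\<Oplus>\<^bsub>M\<^esub>g\<in>carrier G. left_mult g (a g) (inv\<^bsub>G\<^esub> g \<otimes>\<^bsub>G\<^esub> k) (y (inv\<^bsub>G\<^esub> g \<otimes>\<^bsub>G\<^esub> k))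
        \<oplus>\<^bsub>M\<^esub> right_mult g (x g) (inv\<^bsub>G\<^esub> g \<otimes>\<^bsub>G\<^esub> k) (b (inv\<^bsub>G\<^esub> g \<otimes>\<^bsub>G\<^esub> k))
        \<oplus>\<^bsub>M\<^esub> theta_pair g (x g) (inv\<^bsub>G\<^esub> g \<otimes>\<^bsub>G\<^esub> k) (y (inv\<^bsub>G\<^esub> g \<otimes>\<^bsub>G\<^esub> k)))"
      by (rule M.finsum_cong') (use k closed in \<open>auto simp: prod act_closed bimodule_closed\<close>)
    also have "\<dots> = graded_product G R M M left_mult a y k
        \<oplus>\<^bsub>M\<^esub> graded_product G M R M right_mult x b k
        \<oplus>\<^bsub>M\<^esub> graded_product G M M M theta_pair x y k"
      \<comment> \<open>All three convolutions run over \<open>carrier G\<close>, so a sum of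
        three-term summands separates into them.\<close>
      unfolding L.graded_product_app[OF fs(1,4) k] Rt.graded_product_app[OF fs(3,2) k]
        T.graded_product_app[OF fs(3,4) k]
      using k closed by (simp add: M.finsum_addf act_closed bimodule_closed Pi_def)
    finally show ?thesis .
  qed
  have "split_coeffs (u \<otimes>\<^bsub>\<Lambda>G\<^esub> w) = (\<lambda>k\<in>carrier G. fst (?m k), \<lambda>k\<in>carrier G. snd (?m k))"
    by (simp add: split_coeffs_def skew_group_ring_def)
  also have "\<dots> = (graded_product G R R R ring_mult a b,
      \<lambda>k\<in>carrier G. graded_product G R M M left_mult a y k
      \<oplus>\<^bsub>M\<^esub> graded_product G M R M right_mult x b k
      \<oplus>\<^bsub>M\<^esub> graded_product G M M M theta_pair x y k)"
    \<comment> \<open>The first component on the right is not written as a restriction; its values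
      off \<open>carrier G\<close> are settled by the definition of
      \<open>graded_product\<close>.\<close>
    by (auto simp: fst_m snd_m intro!: restrict_ext ext)
      (auto simp: graded_product_def)
  also have "\<dots> = (a, x) \<otimes>\<^bsub>E\<^esub> (b, y)"
    using fs by (simp add: theta_extension_def induced_theta_tensor)
      (auto simp: skew_group_ring_def induced_bimodule_def intro!: restrict_ext)
  also have "\<dots> = split_coeffs u \<otimes>\<^bsub>E\<^esub> split_coeffs w"
    by (simp add: split_coeffs_def a_def b_def x_def y_def)
  finally show ?thesis .
qed

text \<open>The inverse pairs the two coefficient functions pointwise; extensionality turns
  agreement on \<open>carrier G\<close> into equality of functions.\<close>

lemma bij_split_coeffs: "bij_betw split_coeffs (carrier \<Lambda>G) (carrier E)"
proof (rule bij_betw_byWitness[where f' = "\<lambda>p. \<lambda>g\<in>carrier G. (fst p g, snd p g)"])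
  have \<Lambda>G: "carrier \<Lambda>G = carrier G \<rightarrow>\<^sub>E carrier \<Lambda>"
    by (simp add: skew_group_ring_def formal_sums_finite finite_group)
  have E: "carrier E = (carrier G \<rightarrow>\<^sub>E carrier R) \<times> (carrier G \<rightarrow>\<^sub>E carrier M)"
    by (simp add: E_simps formal_sums_finite finite_group)
  show "\<forall>u\<in>carrier \<Lambda>G. (\<lambda>g\<in>carrier G. (fst (split_coeffs u) g, snd (split_coeffs u) g)) = u"
  proof
    fix u assume "u \<in> carrier \<Lambda>G"
    thus "(\<lambda>g\<in>carrier G. (fst (split_coeffs u) g, snd (split_coeffs u) g)) = u"
      using PiE_restrict[of u "carrier G" "\<lambda>_. carrier \<Lambda>"]
      by (simp add: \<Lambda>G split_coeffs_def cong: restrict_cong)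
  qed
  show "\<forall>p\<in>carrier E. split_coeffs (\<lambda>g\<in>carrier G. (fst p g, snd p g)) = p"
  proof
    fix p assume "p \<in> carrier E"
    thus "split_coeffs (\<lambda>g\<in>carrier G. (fst p g, snd p g)) = p"
      using PiE_restrict[of "fst p" "carrier G" "\<lambda>_. carrier R"]
        PiE_restrict[of "snd p" "carrier G" "\<lambda>_. carrier M"]
      by (simp add: E split_coeffs_def mem_Times_iff prod_eq_iff cong: restrict_cong)
  qed
  show "split_coeffs ` carrier \<Lambda>G \<subseteq> carrier E"
    unfolding \<Lambda>G E by (auto simp: split_coeffs_def extension_simps Pi_iff PiE_iff mem_Times_iff)
  show "(\<lambda>p. \<lambda>g\<in>carrier G. (fst p g, snd p g)) ` carrier E \<subseteq> carrier \<Lambda>G"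
    unfolding \<Lambda>G E by (auto simp: extension_simps)
qed

lemma split_coeffs_iso: "split_coeffs \<in> ring_iso \<Lambda>G E"
proof (rule ring_iso_memI)
  show "split_coeffs u \<in> carrier E" if "u \<in> carrier \<Lambda>G" for u
    using bij_split_coeffs that by (rule bij_betwE[rule_format])
  show "split_coeffs (u \<oplus>\<^bsub>\<Lambda>G\<^esub> w) = split_coeffs u \<oplus>\<^bsub>E\<^esub> split_coeffs w" for u w
    unfolding split_coeffs_def E_simps
    by (auto simp: skew_group_ring_def extension_simps intro!: restrict_ext)
  \<comment> \<open>The coefficient at the identity has zero module component, so the second
    function is zero everywhere on \<open>G\<close>.\<close>
  show "split_coeffs \<one>\<^bsub>\<Lambda>G\<^esub> = \<one>\<^bsub>E\<^esub>"
    unfolding split_coeffs_def E_simps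
    by (auto simp: skew_group_ring_def extension_simps monomial_def intro!: restrict_ext)
qed (rule split_coeffs_mult bij_split_coeffs; assumption?)+

text \<open>The ring axioms are transported along the isomorphism. Transport yields the target with
  its zero replaced by the image of zero, so that image is first identified with the zero of
  \<open>E\<close>.\<close>

lemma ring_E: "ring E"
proof -
  have "split_coeffs \<zero>\<^bsub>\<Lambda>G\<^esub> = \<zero>\<^bsub>E\<^esub>"
    unfolding split_coeffs_def E_simps
    by (auto simp: skew_group_ring_def extension_simps intro!: restrict_ext)
  with ring.ring_iso_imp_img_ring[OF \<Lambda>_act.ring_skew_group_ring split_coeffs_iso]
  show ?thesis by simp
qed

end

theorem theorem3p6:
  fixes G :: "('g, 'x) monoid_scheme"
    and \<Gamma> :: "('a, 'y) ring_scheme"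
    and M :: "('a, 'm, 'z) bimodule_scheme"
    and \<phi> :: "'g \<Rightarrow> 'a \<Rightarrow> 'a"
    and \<psi> :: "'g \<Rightarrow> 'm \<Rightarrow> 'm"
    and \<theta> :: "('m \<times> 'm \<Rightarrow>\<^sub>0 int) set \<Rightarrow> 'm"
  assumes "finite (carrier G)"
    and "equivariant_theta_datum G \<Gamma> \<phi> M \<psi> \<theta>"
  shows "let \<Lambda>G = skew_group_ring (theta_extension \<Gamma> M \<theta>) G (extension_action \<Gamma> M \<phi> \<psi>);
             E = theta_extension (skew_group_ring \<Gamma> G \<phi>) (induced_bimodule \<Gamma> M G \<phi> \<psi>)
                   (induced_theta \<Gamma> M G \<phi> \<psi> \<theta>)
         in ring \<Lambda>G \<and> ring E \<and> \<Lambda>G \<simeq> E"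
proof -
  interpret finite_equivariant_theta_datum G \<Gamma> \<phi> M \<psi> \<theta>
    using assms
    by (intro finite_equivariant_theta_datum.intro finite_equivariant_theta_datum_axioms.intro)
  show ?thesis
    using \<Lambda>_act.ring_skew_group_ring ring_E split_coeffs_iso
    by (auto simp: is_ring_iso_def)
qed

end
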